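(* If $G$ is a 1-planar graph, then $\chi'_{\equiv}(G)\leq 18$; that is, $G$ has an equitable edge $k$-coloring for every integer $k\geq 18$.
   Context: All graphs are finite, simple and undirected. A graph is 1-planar if it can be drawn in the plane (vertices as distinct points, edges as simple arcs joining their endpoints and passing through no other vertices) so that each edge is crossed by at most one other edge, with usual conventions for drawings (in particular, each edge has at most one crossing). An edge $k$-coloring here is any function $\varphi:E(G)\to\{1,2,\ldots,k\}$ (not necessarily proper). For $v\in V(G)$ let $c_i(\varphi,v)=|\{uv\in E(G) : \varphi(uv)=i\}|$. The edge $k$-coloring $\varphi$ is equitable if $|c_i(\varphi,v)-c_j(\varphi,v)|\leq 1$ for every $v\in V(G)$ and all $1\leq i<j\leq k$. The equitable edge chromatic threshold $\chi'_{\equiv}(G)$ is the smallest $k$ such that $G$ has an equitable edge $k'$-coloring for every integer $k'\geq k$. *)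

theory Defs
  imports "HOL-Analysis.Analysis"
begin

definition simple_graph :: "'a set \<Rightarrow> 'a set set \<Rightarrow> bool" where
  "simple_graph V E \<longleftrightarrow> finite V \<and> (\<forall>e\<in>E. e \<subseteq> V \<and> card e = 2)"

text \<open>The plane is \<^typ>\<open>complex\<close>; \<^term>\<open>pos v\<close> is the point representing the vertex
  \<^term>\<open>v\<close>, and \<^term>\<open>\<gamma> e\<close> is a simple arc representing the edge \<^term>\<open>e\<close>, in either
  orientation.\<close>

definition plane_drawing ::
  "'a set \<Rightarrow> 'a set set \<Rightarrow> ('a \<Rightarrow> complex) \<Rightarrow> ('a set \<Rightarrow> real \<Rightarrow> complex) \<Rightarrow> bool" where
  "plane_drawing V E pos \<gamma> \<longleftrightarrow>
     inj_on pos V \<and>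
     (\<forall>e\<in>E. arc (\<gamma> e) \<and>
        {pathstart (\<gamma> e), pathfinish (\<gamma> e)} = pos ` e \<and>
        path_image (\<gamma> e) \<inter> pos ` V = pos ` e)"

text \<open>A crossing of \<^term>\<open>e\<close> is recorded together with the other edge involved. Every common
  point of two arcs other than a vertex counts as a crossing, so several edges through one
  point, or several common points of the same two edges, give several crossings.\<close>

definition crossings ::
  "'a set \<Rightarrow> 'a set set \<Rightarrow> ('a \<Rightarrow> complex) \<Rightarrow> ('a set \<Rightarrow> real \<Rightarrow> complex) \<Rightarrow> 'a set \<Rightarrow>
     ('a set \<times> complex) set" where
  "crossings V E pos \<gamma> e =
     {(f, p). f \<in> E \<and> f \<noteq> e \<and> p \<in> path_image (\<gamma> e) \<inter> path_image (\<gamma> f) \<and> p \<notin> pos ` V}"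

definition one_planar :: "'a set \<Rightarrow> 'a set set \<Rightarrow> bool" where
  "one_planar V E \<longleftrightarrow>
     (\<exists>pos \<gamma>. plane_drawing V E pos \<gamma> \<and>
        (\<forall>e\<in>E. \<forall>x\<in>crossings V E pos \<gamma> e. \<forall>y\<in>crossings V E pos \<gamma> e. x = y))"

definition edge_coloring :: "'a set set \<Rightarrow> nat \<Rightarrow> ('a set \<Rightarrow> nat) \<Rightarrow> bool" where
  "edge_coloring E k \<phi> \<longleftrightarrow> \<phi> ` E \<subseteq> {1..k}"

definition color_degree :: "'a set set \<Rightarrow> ('a set \<Rightarrow> nat) \<Rightarrow> nat \<Rightarrow> 'a \<Rightarrow> nat" where
  "color_degree E \<phi> i v = card {e \<in> E. v \<in> e \<and> \<phi> e = i}"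

definition equitable_edge_coloring ::
  "'a set \<Rightarrow> 'a set set \<Rightarrow> nat \<Rightarrow> ('a set \<Rightarrow> nat) \<Rightarrow> bool" where
  "equitable_edge_coloring V E k \<phi> \<longleftrightarrow>
     edge_coloring E k \<phi> \<and>
     (\<forall>v\<in>V. \<forall>i j. 1 \<le> i \<and> i < j \<and> j \<le> k \<longrightarrow>
        \<bar>int (color_degree E \<phi> i v) - int (color_degree E \<phi> j v)\<bar> \<le> 1)"

definition equitable_edge_chromatic_threshold :: "'a set \<Rightarrow> 'a set set \<Rightarrow> nat" where
  "equitable_edge_chromatic_threshold V E =
     (LEAST k. \<forall>k'\<ge>k. \<exists>\<phi>. equitable_edge_coloring V E k' \<phi>)"

text \<open>For a finite graph the set whose least element is taken above is nonempty: with
  \<^term>\<open>card E\<close> or more colors, all edges can receive different colors.\<close>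

lemma equitable_edge_coloring_if_card_le:
  assumes "simple_graph V E" "card E \<le> k"
  shows "\<exists>\<phi>. equitable_edge_coloring V E k \<phi>"
proof -
  have "E \<subseteq> Pow V" "finite V"
    using assms(1) by (auto simp: simple_graph_def)
  then have "finite E"
    by (meson finite_Pow_iff finite_subset)
  then obtain \<phi> where \<phi>: "inj_on \<phi> E" "\<phi> ` E \<subseteq> {1..k}"
    using card_le_inj[of E "{1..k}"] assms(2) by auto
  have le: "color_degree E \<phi> i v \<le> 1" for i v
    unfolding color_degree_def
    by (rule card_le_Suc0_iff_eq[THEN iffD2, folded One_nat_def])
      (use \<open>finite E\<close> \<phi>(1) in \<open>auto simp: inj_on_def\<close>)
  have "\<bar>int (color_degree E \<phi> i v) - int (color_degree E \<phi> j v)\<bar> \<le> 1" for i j v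
    using le[of i v] le[of j v] by linarith
  then show ?thesis
    using \<phi>(2) by (auto simp: equitable_edge_coloring_def edge_coloring_def)
qed

lemma equitable_edge_chromatic_threshold_le_iff:
  assumes "simple_graph V E"
  shows "equitable_edge_chromatic_threshold V E \<le> m \<longleftrightarrow>
    (\<forall>k\<ge>m. \<exists>\<phi>. equitable_edge_coloring V E k \<phi>)"
proof
  let ?P = "\<lambda>k. \<forall>k'\<ge>k. \<exists>\<phi>. equitable_edge_coloring V E k' \<phi>"
  assume le: "equitable_edge_chromatic_threshold V E \<le> m"
  have "?P (card E)"
    using equitable_edge_coloring_if_card_le[OF assms] by blast
  then have "?P (equitable_edge_chromatic_threshold V E)"
    unfolding equitable_edge_chromatic_threshold_def by (rule LeastI)
  with le show "?P m"
    using le_trans by blast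
next
  assume "\<forall>k\<ge>m. \<exists>\<phi>. equitable_edge_coloring V E k \<phi>"
  then show "equitable_edge_chromatic_threshold V E \<le> m"
    unfolding equitable_edge_chromatic_threshold_def by (rule Least_le)
qed

end

theory Submission
  imports Defs
begin

text \<open>Splitting every vertex into copies of degree at most \<open>k\<close> turns an equitable coloring with \<open>k\<close>
  colors into a proper one. If the split graph had no proper coloring with \<open>k\<close> colors, it would
  contain a critical subgraph, and for \<open>k \<ge> 18\<close> Vizing's adjacency lemma and discharging give this
  subgraph average degree at least 12. Merging the copies again can only raise the average degree, so
  \<open>G\<close> would have a subgraph with \<open>n\<close> vertices and at least \<open>6 n\<close> edges. But the edges of a 1-planar
  graph are covered by two plane graphs, each with at most \<open>3 n - 3\<close> edges.\<close>

section \<open>Vizing fans and Kempe changes\<close>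

text \<open>The constant 12 is the bound on the average degree: two plane graphs on \<open>n\<close>
  vertices have together fewer than \<open>6 n\<close> edges. The constant 18 is 12 plus the surplus
  that discharging needs. A vertex of degree \<open>k\<close> owns \<open>k - 12\<close>, and a
  surplus of 6 is just enough: a vertex of degree 3 or 4 whose neighbors all have degree
  \<open>k\<close> is guaranteed 3 shares of \<open>6 / 2\<close> or 4 shares of
  \<open>6 / 3\<close>, exactly what it lacks to 12. Splitting is what makes the adjacency lemma
  applicable, since this lemma requires all degrees to be at most \<open>k\<close>. The edges at a
  vertex are distributed arbitrarily, so the split graph need not be 1-planar; only numbers of edges
  and vertices are transferred, and sparsity is required of every subgraph of \<open>G\<close>.
  Edges of a drawing are arbitrary arcs. The bound for plane graphs is therefore obtained without
  faces, from the Jordan curve theorem and theta curves: edges and vertices inside a cycle are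
  counted by induction, and a cycle with the most edges inside accounts for the whole graph. The
  form \<open>3 n - 3\<close> also fits a single edge and is preserved when two graphs are glued at
  a vertex.\<close>

definition proper_edge_coloring :: "'a set set \<Rightarrow> nat \<Rightarrow> ('a set \<Rightarrow> nat) \<Rightarrow> bool" where
  "proper_edge_coloring E k c \<longleftrightarrow>
     c ` E \<subseteq> {1..k} \<and> (\<forall>v. inj_on c {e \<in> E. v \<in> e})"

definition edge_colorable :: "'a set set \<Rightarrow> nat \<Rightarrow> bool" where
  "edge_colorable E k \<longleftrightarrow> (\<exists>c. proper_edge_coloring E k c)"

definition vdeg :: "'a set set \<Rightarrow> 'a \<Rightarrow> nat" where
  "vdeg E v = card {e \<in> E. v \<in> e}"

definition missing :: "'a set set \<Rightarrow> nat \<Rightarrow> ('a set \<Rightarrow> nat) \<Rightarrow> 'a \<Rightarrow> nat set" where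
  "missing E k c v = {1..k} - c ` {e \<in> E. v \<in> e}"

lemma proper_edge_coloringD:
  assumes "proper_edge_coloring E k c" "e \<in> E" "f \<in> E" "v \<in> e" "v \<in> f" "c e = c f"
  shows "e = f"
  using assms unfolding proper_edge_coloring_def inj_on_def by blast

lemma card_missing:
  assumes "finite E" "proper_edge_coloring E k c"
  shows "card (missing E k c v) + vdeg E v = k"
proof -
  let ?A = "{e \<in> E. v \<in> e}"
  have c: "card (c ` ?A) = vdeg E v"
    using assms(2) by (simp add: proper_edge_coloring_def vdeg_def card_image)
  have sub: "c ` ?A \<subseteq> {1..k}"
    using assms(2) by (auto simp: proper_edge_coloring_def)
  have "card (missing E k c v) = k - card (c ` ?A)"
    unfolding missing_def using sub assms(1) by (subst card_Diff_subset) auto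
  moreover have "card (c ` ?A) \<le> k"
    using card_mono[OF _ sub] by simp
  ultimately show ?thesis using c by simp
qed

text \<open>The uncolored edge is shifted along the fan until it can be colored.\<close>

lemma fan_colorable:
  assumes "\<forall>e\<in>E. card e = 2"
    and "proper_edge_coloring (E - {{y, x}}) k c"
    and "distinct (x # xs)" "\<forall>z\<in>set (x # xs). {y, z} \<in> E"
    and "successively (\<lambda>u w. c {y, w} \<in> missing (E - {{y, x}}) k c u) (x # xs)"
    and "\<alpha> \<in> missing (E - {{y, x}}) k c (last (x # xs))"
    and "\<alpha> \<in> missing (E - {{y, x}}) k c y"
  shows "edge_colorable E k"
  using assms(2-)
proof (induction xs arbitrary: x c)
  case Nil
  let ?c = "c({y, x} := \<alpha>)"
  have "proper_edge_coloring E k ?c"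
    unfolding proper_edge_coloring_def
  proof (intro conjI allI)
    show "?c ` E \<subseteq> {1..k}"
      using Nil.prems by (auto simp: proper_edge_coloring_def missing_def)
    fix v
    show "inj_on ?c {e \<in> E. v \<in> e}"
    proof (rule inj_onI)
      fix e f assume ef: "e \<in> {e \<in> E. v \<in> e}" "f \<in> {e \<in> E. v \<in> e}" "?c e = ?c f"
      have new: False if "h \<in> E" "h \<noteq> {y, x}" "v \<in> h" "v = y \<or> v = x" "\<alpha> = c h" for h
        using Nil.prems(5,6) that by (auto simp: missing_def)
      have old: "e = f" if "e \<noteq> {y, x}" "f \<noteq> {y, x}"
        by (rule proper_edge_coloringD[OF Nil.prems(1), of e f v]) (use ef that in auto)
      show "e = f"
        using ef old new[of e] new[of f] by (auto split: if_splits)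
    qed
  qed
  then show ?case by (auto simp: edge_colorable_def)
next
  case (Cons x1 xs)
  let ?E0 = "E - {{y, x}}" and ?E1 = "E - {{y, x1}}"
  \<comment> \<open>\<open>{y, x}\<close> takes over the color of \<open>{y, x1}\<close>, which
    becomes the uncolored edge; what remains is the shorter fan that starts at
    \<open>x1\<close>.\<close>
  let ?c = "c({y, x} := c {y, x1})"
  have ne: "x \<noteq> x1" "{y, x} \<in> E" "{y, x1} \<in> E" "{y, x} \<noteq> {y, x1}"
    using Cons.prems(2,3) by (auto simp: doubleton_eq_iff)
  have yne: "y \<noteq> z" if "{y, z} \<in> E" for z
    using assms(1) that by fastforce
  have mx: "c {y, x1} \<in> missing ?E0 k c x"
    using Cons.prems(4) by simp
  have P: "proper_edge_coloring ?E1 k ?c"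
    unfolding proper_edge_coloring_def
  proof (intro conjI allI)
    show "?c ` ?E1 \<subseteq> {1..k}"
    proof -
      have "c {y, x1} \<in> {1..k}" using mx by (simp add: missing_def)
      moreover have "c ` ?E0 \<subseteq> {1..k}" using Cons.prems(1) by (simp add: proper_edge_coloring_def)
      ultimately show ?thesis by auto
    qed
    fix v
    have old: "e = f" if "e \<in> E" "e \<noteq> {y, x}" "f \<in> E" "f \<noteq> {y, x}" "v \<in> e" "v \<in> f" "c e = c f" for e f
      by (rule proper_edge_coloringD[OF Cons.prems(1)]) (use that in auto)
    have new: False if "f \<in> E" "f \<noteq> {y, x}" "f \<noteq> {y, x1}" "v \<in> f" "v = y \<or> v = x" "c {y, x1} = c f" for f
    proof (cases "v = y")
      case True
      then show False
        using proper_edge_coloringD[OF Cons.prems(1), of f "{y,x1}" y] that ne by auto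
    next
      case False
      then show False using mx that by (auto simp: missing_def)
    qed
    show "inj_on ?c {e \<in> ?E1. v \<in> e}"
    proof (rule inj_onI)
      fix e f assume ef: "e \<in> {e \<in> ?E1. v \<in> e}" "f \<in> {e \<in> ?E1. v \<in> e}" "?c e = ?c f"
      show "e = f"
        using ef old[of e f] new[of e] new[of f]
        by (auto split: if_splits)
    qed
  qed
  \<comment> \<open>The colors seen at \<open>y\<close> stay the same. Of the fan vertices only
    \<open>x\<close> sees a new color, and \<open>x\<close> has left the fan.\<close>
  have mono: "missing ?E0 k c z \<subseteq> missing ?E1 k ?c z" if "z \<in> set (x1 # xs) \<or> z = y" for z
  proof
    fix b assume b: "b \<in> missing ?E0 k c z"
    have zx: "z \<noteq> x" using that Cons.prems(2,3) yne by auto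
    have "b \<noteq> c {y, x1}" if "z = y"
      using b that ne by (auto simp: missing_def)
    with zx b show "b \<in> missing ?E1 k ?c z"
      by (auto simp: missing_def)
  qed
  have S: "successively (\<lambda>u w. ?c {y, w} \<in> missing ?E1 k ?c u) (x1 # xs)"
  proof -
    have "successively (\<lambda>u w. c {y, w} \<in> missing ?E0 k c u) (x1 # xs)"
      using Cons.prems(4) by simp
    then show ?thesis
    proof (rule successively_mono)
      fix u w assume uw: "u \<in> set (x1 # xs)" "w \<in> set (x1 # xs)"
        and "c {y, w} \<in> missing ?E0 k c u"
      moreover have "w \<noteq> x" using uw Cons.prems(2) by auto
      ultimately show "?c {y, w} \<in> missing ?E1 k ?c u"
        using mono[of u] by (auto simp: doubleton_eq_iff)
    qed
  qed
  have l: "\<alpha> \<in> missing ?E1 k ?c (last (x1 # xs))" "\<alpha> \<in> missing ?E1 k ?c y"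
    using Cons.prems(5,6) mono[of "last (x1 # xs)"] mono[of y] last_in_set[of "x1 # xs"]
    by (auto simp del: last.simps simp: last_ConsR)
  show ?case
    by (rule Cons.IH[OF P _ _ S l]) (use Cons.prems(2,3) in auto)
qed

section \<open>Kempe changes and two-colored components\<close>

definition swap_color :: "nat \<Rightarrow> nat \<Rightarrow> nat \<Rightarrow> nat" where
  "swap_color a b i = (if i = a then b else if i = b then a else i)"

lemma inj_swap_color: "inj (swap_color a b)"
  by (auto simp: inj_on_def swap_color_def split: if_splits)

text \<open>\<open>S\<close> is a union of components of the subgraph of the edges colored \<open>a\<close> or \<open>b\<close>.\<close>

lemma kempe_swap:
  assumes P: "proper_edge_coloring E k c" and ab: "a \<in> {1..k}" "b \<in> {1..k}"
    and S: "\<And>e. e \<in> E \<Longrightarrow> c e \<in> {a, b} \<Longrightarrow> e \<inter> S \<noteq> {} \<Longrightarrow> e \<subseteq> S"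
  shows "\<exists>c'. proper_edge_coloring E k c' \<and> (\<forall>e\<in>E. \<forall>v\<in>e. v \<notin> S \<longrightarrow> c' e = c e) \<and>
    (\<forall>v. v \<notin> S \<longrightarrow> missing E k c' v = missing E k c v) \<and>
    (\<forall>v\<in>S. missing E k c' v = swap_color a b ` missing E k c v)"
proof -
  let ?c = "\<lambda>e. if e \<inter> S \<noteq> {} then swap_color a b (c e) else c e"
  \<comment> \<open>An edge that meets \<open>S\<close> without lying in it has neither color
    \<open>a\<close> nor \<open>b\<close>, so the swap does not affect it.\<close>
  have eq: "?c e = c e" if "e \<in> E" "v \<in> e" "v \<notin> S" for e v
    using S[of e] that by (auto simp: swap_color_def)
  have eqS: "?c e = swap_color a b (c e)" if "v \<in> e" "v \<in> S" for e v
    using that by auto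
  have im1: "?c ` {e \<in> E. v \<in> e} = c ` {e \<in> E. v \<in> e}" if "v \<notin> S" for v
    by (rule image_cong[OF refl]) (use eq that in blast)
  have im2: "?c ` {e \<in> E. v \<in> e} = swap_color a b ` (c ` {e \<in> E. v \<in> e})" if "v \<in> S" for v
    unfolding image_image by (rule image_cong[OF refl]) (use eqS that in blast)
  have sk: "swap_color a b ` {1..k} = {1..k}"
  proof (rule endo_inj_surj)
    show "swap_color a b ` {1..k} \<subseteq> {1..k}" using ab by (auto simp: swap_color_def)
    show "inj_on (swap_color a b) {1..k}" using inj_swap_color by (rule inj_on_subset) auto
  qed auto
  have m1: "missing E k ?c v = missing E k c v" if "v \<notin> S" for v
    unfolding missing_def by (subst im1[OF that]) rule
  have m2: "missing E k ?c v = swap_color a b ` missing E k c v" if "v \<in> S" for v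
    unfolding missing_def
    by (subst im2[OF that], subst image_set_diff[OF inj_swap_color], subst sk) rule
  have "proper_edge_coloring E k ?c"
    unfolding proper_edge_coloring_def
  proof (intro conjI allI)
    show "?c ` E \<subseteq> {1..k}" using P ab by (auto simp: proper_edge_coloring_def swap_color_def)
    fix v
    have i: "inj_on c {e \<in> E. v \<in> e}" using P by (simp add: proper_edge_coloring_def)
    show "inj_on ?c {e \<in> E. v \<in> e}"
    proof (cases "v \<in> S")
      case True
      have "inj_on (swap_color a b \<circ> c) {e \<in> E. v \<in> e}"
        using i inj_swap_color by (intro comp_inj_on) (auto intro: inj_on_subset)
      moreover have "inj_on ?c {e \<in> E. v \<in> e} = inj_on (swap_color a b \<circ> c) {e \<in> E. v \<in> e}"
        by (rule inj_on_cong) (use True in auto)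
      ultimately show ?thesis by simp
    next
      case False
      have "inj_on ?c {e \<in> E. v \<in> e} = inj_on c {e \<in> E. v \<in> e}"
        by (rule inj_on_cong) (use eq False in blast)
      with i show ?thesis by simp
    qed
  qed
  with eq m1 m2 show ?thesis by (intro exI[of _ ?c]) blast
qed

lemma sum_vdeg:
  assumes "finite E" "\<forall>e\<in>E. card e = 2" "\<Union>E \<subseteq> V" "finite V"
  shows "(\<Sum>v\<in>V. vdeg E v) = 2 * card E"
proof -
  have "(\<Sum>v\<in>V. vdeg E v) = (\<Sum>v\<in>V. \<Sum>e\<in>E. if v \<in> e then 1 else 0)"
    using assms(1) by (intro sum.cong refl) (simp add: vdeg_def sum.If_cases Int_def)
  also have "\<dots> = (\<Sum>e\<in>E. \<Sum>v\<in>V. if v \<in> e then 1 else 0)"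
    by (rule sum.swap)
  also have "\<dots> = (\<Sum>e\<in>E. card e)"
  proof (rule sum.cong[OF refl])
    fix e assume "e \<in> E"
    then have "V \<inter> e = e" using assms(3) by auto
    then show "(\<Sum>v\<in>V. if v \<in> e then 1 else 0) = card e"
      using assms(4) by (simp add: sum.If_cases)
  qed
  also have "\<dots> = 2 * card E" using assms(2) by simp
  finally show ?thesis .
qed

text \<open>A connected graph on \<open>n\<close> vertices has at least \<open>n - 1\<close> edges, so with maximal degree 2
  its degree sum leaves no room for three vertices of degree 1.\<close>

lemma three_ends_not_connected:
  assumes fin: "finite H" and two: "\<forall>e\<in>H. card e = 2" and deg: "\<And>v. vdeg H v \<le> 2"
    and conn: "u \<in> {(v, w). {v, w} \<in> H}\<^sup>* `` {y}" "w \<in> {(v, w). {v, w} \<in> H}\<^sup>* `` {y}"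
    and dist: "y \<noteq> u" "y \<noteq> w" "u \<noteq> w"
    and ends: "vdeg H y \<le> 1" "vdeg H u \<le> 1" "vdeg H w \<le> 1"
  shows False
proof -
  define r where "r = {(v, w). {v, w} \<in> H}"
  define C where "C = r\<^sup>* `` {y}"
  have finH: "finite (\<Union>H)" by (rule finite_Union[OF fin]) (use two in \<open>auto intro!: card_ge_0_finite\<close>)
  have Csub: "C \<subseteq> insert y (\<Union>H)"
  proof
    fix z assume "z \<in> C"
    then have "(y, z) \<in> r\<^sup>*" by (simp add: C_def)
    then show "z \<in> insert y (\<Union>H)" by cases (auto simp: r_def)
  qed
  have finC: "finite C" using Csub finH finite_subset by blast
  \<comment> \<open>\<open>good\<close> compares vertices with induced edges. A largest good set
    cannot be extended along an edge leaving it, so it equals \<open>C\<close>; this gives the edge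
    bound of a spanning tree without constructing one.\<close>
  define good where "good A \<longleftrightarrow> y \<in> A \<and> A \<subseteq> C \<and> card A \<le> card {e \<in> H. e \<subseteq> A} + 1" for A
  have "good {y}" by (auto simp: good_def C_def)
  moreover have "\<forall>B. good B \<longrightarrow> card B < Suc (card C)"
    using card_mono[OF finC] by (simp add: good_def less_Suc_eq_le)
  ultimately obtain A where A: "good A" and mx: "\<forall>B. good B \<longrightarrow> card B \<le> card A"
    using Lattices_Big.ex_has_greatest_nat[of good "{y}" card "Suc (card C)"] by blast
  have finA: "finite A" using A finC finite_subset unfolding good_def by blast
  have "A = C"
  proof (rule ccontr)
    assume "A \<noteq> C"
    have "\<exists>p q. p \<in> A \<and> q \<notin> A \<and> (p, q) \<in> r"
    proof (rule ccontr)
      assume no: "\<not> ?thesis"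
      have "z \<in> A" if "(y, z) \<in> r\<^sup>*" for z
        using that A no by induction (auto simp: good_def)
      then show False using A \<open>A \<noteq> C\<close> by (auto simp: good_def C_def)
    qed
    then obtain p q where pq: "p \<in> A" "q \<notin> A" "(p, q) \<in> r" by blast
    have "p \<in> C" using A pq by (auto simp: good_def)
    then have "q \<in> C" using pq by (auto simp: C_def)
    have sub: "insert {p, q} {e \<in> H. e \<subseteq> A} \<subseteq> {e \<in> H. e \<subseteq> insert q A}"
      using pq by (auto simp: r_def)
    have "card {e \<in> H. e \<subseteq> A} + 1 = card (insert {p, q} {e \<in> H. e \<subseteq> A})"
      using fin pq by (subst card_insert_disjoint) auto
    also have "\<dots> \<le> card {e \<in> H. e \<subseteq> insert q A}"
      using sub fin by (intro card_mono) auto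
    finally have "good (insert q A)"
      using A \<open>q \<in> C\<close> pq finA by (auto simp: good_def)
    with mx have "card (insert q A) \<le> card A" by blast
    then show False using pq finA by simp
  qed
  let ?HC = "{e \<in> H. e \<subseteq> C}"
  have "2 * card C \<le> 2 * card ?HC + 2"
    using A \<open>A = C\<close> by (auto simp: good_def)
  also have "2 * card ?HC = (\<Sum>v\<in>C. vdeg ?HC v)"
    using fin two finC by (intro sum_vdeg[symmetric]) auto
  also have "\<dots> \<le> (\<Sum>v\<in>C. vdeg H v)"
    unfolding vdeg_def using fin by (intro sum_mono card_mono) auto
  also have "\<dots> = (\<Sum>v\<in>C - {y, u, w}. vdeg H v) + (\<Sum>v\<in>{y, u, w}. vdeg H v)"
  proof (rule sum.subset_diff)
    show "{y, u, w} \<subseteq> C" using conn by (auto simp: C_def r_def)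
  qed (rule finC)
  also have "(\<Sum>v\<in>C - {y, u, w}. vdeg H v) \<le> (\<Sum>v\<in>C - {y, u, w}. 2)"
    by (intro sum_mono deg)
  also have "(\<Sum>v\<in>C - {y, u, w}. 2) = 2 * (card C - 3)"
  proof -
    have "{y, u, w} \<subseteq> C" using conn by (auto simp: C_def r_def)
    then have "card (C - {y, u, w}) = card C - card {y, u, w}"
      using finC by (intro card_Diff_subset) auto
    with dist show ?thesis by simp
  qed
  also have "(\<Sum>v\<in>{y, u, w}. vdeg H v) \<le> 3"
    using dist ends by simp
  finally have "2 * card C \<le> 2 * (card C - 3) + 3 + 2" by simp
  moreover have "card C \<ge> 3"
  proof -
    have "{y, u, w} \<subseteq> C" using conn by (auto simp: C_def r_def)
    from card_mono[OF finC this] dist show ?thesis by simp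
  qed
  ultimately show False by simp
qed

section \<open>Maximal fans and Vizing's adjacency lemma\<close>

lemma rtrancl_imp_distinct_path:
  assumes "(x, u) \<in> r\<^sup>*"
  obtains xs where "distinct (x # xs)" "successively (\<lambda>a b. (a, b) \<in> r) (x # xs)" "last (x # xs) = u"
proof -
  have "\<exists>xs. distinct (x # xs) \<and> successively (\<lambda>a b. (a, b) \<in> r) (x # xs) \<and> last (x # xs) = u"
    using assms
  proof induction
    case base
    show ?case by (intro exI[of _ "[]"]) auto
  next
    case (step u w)
    then obtain xs where xs: "distinct (x # xs)" "successively (\<lambda>a b. (a, b) \<in> r) (x # xs)" "last (x # xs) = u"
      by blast
    show ?case
    proof (cases "w \<in> set (x # xs)")
      case True
      then obtain ys zs where "x # xs = ys @ w # zs" by (meson split_list)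
      then have eq: "x # xs = (ys @ [w]) @ zs" by simp
      define vs where "vs = tl (ys @ [w])"
      have vs: "x # vs = ys @ [w]"
        using eq by (cases ys) (auto simp: vs_def)
      have "distinct (x # vs)" "successively (\<lambda>a b. (a, b) \<in> r) (x # vs)" "last (x # vs) = w"
        unfolding vs using xs(1,2) unfolding eq by (simp_all add: successively_append_iff)
      then show ?thesis by blast
    next
      case False
      have "distinct (x # (xs @ [w]))" using xs(1) False by auto
      moreover have "successively (\<lambda>a b. (a, b) \<in> r) (x # (xs @ [w]))"
        using xs(2,3) step.hyps(2) unfolding append_Cons[symmetric] by (subst successively_append_iff) simp
      moreover have "last (x # (xs @ [w])) = w" by simp
      ultimately show ?thesis by blast
    qed
  qed
  then show thesis using that by blast
qed

lemma successively_imp_predecessor: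
  assumes "successively P (x # xs)" "z \<in> set xs"
  shows "\<exists>u. P u z"
  using assms
proof (induction xs arbitrary: x)
  case (Cons a xs)
  then show ?case by (cases "z = a") auto
qed simp

text \<open>The maximal fan at \<open>y\<close> is the set reachable from \<open>x\<close> under
  this relation, which needs no order on the fan. Fans in the form of lists are recovered as
  repetition-free paths.\<close>

definition fan_step :: "'a set set \<Rightarrow> nat \<Rightarrow> ('a set \<Rightarrow> nat) \<Rightarrow> 'a \<Rightarrow> ('a \<times> 'a) set" where
  "fan_step E k c y = {(u, w). {y, w} \<in> E \<and> c {y, w} \<in> missing E k c u}"

text \<open>Such a color would serve as the last color of the shift along a repetition-free fan from
  \<open>x\<close> to \<open>u\<close>.\<close>

lemma fan_missing_disjoint:
  assumes two: "\<forall>e\<in>E. card e = 2" and nc: "\<not> edge_colorable E k" and yx: "{y, x} \<in> E"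
    and P: "proper_edge_coloring (E - {{y, x}}) k c"
    and u: "(x, u) \<in> (fan_step (E - {{y, x}}) k c y)\<^sup>*"
    and a: "a \<in> missing (E - {{y, x}}) k c u" "a \<in> missing (E - {{y, x}}) k c y"
  shows False
proof -
  obtain xs where xs: "distinct (x # xs)"
      "successively (\<lambda>a b. (a, b) \<in> fan_step (E - {{y, x}}) k c y) (x # xs)" "last (x # xs) = u"
    using rtrancl_imp_distinct_path[OF u] by blast
  have "{y, z} \<in> E" if "z \<in> set (x # xs)" for z
    using that successively_imp_predecessor[OF xs(2), of z] yx by (auto simp: fan_step_def)
  moreover have "successively (\<lambda>u w. c {y, w} \<in> missing (E - {{y, x}}) k c u) (x # xs)"
    by (rule successively_mono[OF xs(2)]) (auto simp: fan_step_def)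
  ultimately have "edge_colorable E k"
    using fan_colorable[OF two P xs(1)] a xs(3) by blast
  with nc show False ..
qed

text \<open>Otherwise swapping the two colors on the component of \<open>u\<close> would keep an initial part of the
  fan intact and end it in a vertex that misses \<open>a\<close>, which is still missing at \<open>y\<close>.\<close>

lemma vizing_fan_kempe:
  assumes two: "\<forall>e\<in>E. card e = 2" and nc: "\<not> edge_colorable E k"
    and yx: "{y, x} \<in> E" and E0: "E0 = E - {{y, x}}"
    and P: "proper_edge_coloring E0 k c"
    and u: "(x, u) \<in> (fan_step E0 k c y)\<^sup>*" "b \<in> missing E0 k c u"
    and a: "a \<in> missing E0 k c y"
  shows "(u, y) \<in> {(v, w). {v, w} \<in> {e \<in> E0. c e \<in> {a, b}}}\<^sup>*"
proof (rule ccontr)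
  define r where "r = {(v, w). {v, w} \<in> {e \<in> E0. c e \<in> {a, b}}}"
  define S where "S = r\<^sup>* `` {u}"
  assume "\<not> ?thesis"
  then have yS: "y \<notin> S" by (simp add: S_def r_def)
  have uS: "u \<in> S" by (simp add: S_def)
  have ab: "a \<in> {1..k}" "b \<in> {1..k}" using a u(2) by (auto simp: missing_def)
  have closed: "e \<subseteq> S" if e: "e \<in> E0" "c e \<in> {a, b}" "e \<inter> S \<noteq> {}" for e
  proof -
    have "card e = 2" using e(1) two E0 by blast
    then obtain p q where pq: "e = {p, q}" by (meson card_2_iff)
    then have "(p, q) \<in> r" "(q, p) \<in> r" using e by (auto simp: r_def insert_commute)
    then have "p \<in> S \<longleftrightarrow> q \<in> S" unfolding S_def by (meson Image_singleton_iff rtrancl_into_rtrancl)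
    with e(3) pq show ?thesis by auto
  qed
  obtain c' where c': "proper_edge_coloring E0 k c'"
      "\<forall>e\<in>E0. \<forall>v\<in>e. v \<notin> S \<longrightarrow> c' e = c e"
      "\<forall>v. v \<notin> S \<longrightarrow> missing E0 k c' v = missing E0 k c v"
      "\<forall>v\<in>S. missing E0 k c' v = swap_color a b ` missing E0 k c v"
    using kempe_swap[OF P ab, of S] closed by auto
  \<comment> \<open>A vertex of \<open>S\<close> that missed \<open>b\<close> misses
    \<open>a\<close> after the swap, and so does \<open>y\<close>, which lies off \<open>S\<close>.
    The new fan must not reach such a vertex.\<close>
  have noR: False if "z \<in> S" "b \<in> missing E0 k c z" "(x, z) \<in> (fan_step E0 k c' y)\<^sup>*" for z
  proof -
    have "swap_color a b b = a" by (simp add: swap_color_def)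
    then have "a \<in> missing E0 k c' z" using c'(4) that(1,2) by (metis imageI)
    moreover have "a \<in> missing E0 k c' y" using c'(3) yS a by blast
    ultimately show False
      using fan_missing_disjoint[OF two nc yx] c'(1) that(3) unfolding E0 by blast
  qed
  have "(x, z) \<in> (fan_step E0 k c' y)\<^sup>*" if "(x, z) \<in> (fan_step E0 k c y)\<^sup>*" for z
    using that
  proof induction
    case (step z w)
    have w: "{y, w} \<in> E0" "c {y, w} \<in> missing E0 k c z"
      using step.hyps(2) by (auto simp: fan_step_def)
    have eq: "c' {y, w} = c {y, w}" using c'(2) w(1) yS by blast
    have na: "c {y, w} \<noteq> a" using a w(1) by (auto simp: missing_def)
    \<comment> \<open>Color \<open>a\<close> is missing at \<open>y\<close>, so no fan edge has it;
      color \<open>b\<close> is excluded by \<open>noR\<close> if \<open>z\<close> lies in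
      \<open>S\<close>. Hence the swap destroys no step of the fan.\<close>
    have "c {y, w} \<in> missing E0 k c' z"
    proof (cases "z \<in> S")
      case True
      then have "c {y, w} \<noteq> b" using noR[OF True] step.IH w(2) by auto
      with na have "swap_color a b (c {y, w}) = c {y, w}" by (simp add: swap_color_def)
      with c'(4) True w(2) show ?thesis by (metis imageI)
    next
      case False
      with c'(3) w(2) show ?thesis by blast
    qed
    then have "(z, w) \<in> fan_step E0 k c' y" using w(1) eq by (simp add: fan_step_def)
    with step.IH show ?case by (rule rtrancl_into_rtrancl)
  qed simp
  then show False using noR uS u by blast
qed

lemma bichromatic_vdeg:
  assumes P: "proper_edge_coloring E k c" and "finite D"
  shows "vdeg {e \<in> E. c e \<in> D} v \<le> card (D - missing E k c v)"
proof -
  let ?A = "{e \<in> {e \<in> E. c e \<in> D}. v \<in> e}"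
  have i: "inj_on c ?A"
    using P by (auto simp: proper_edge_coloring_def intro: inj_on_subset)
  have "c ` ?A \<subseteq> D - missing E k c v" by (auto simp: missing_def)
  then have "card (c ` ?A) \<le> card (D - missing E k c v)" using assms(2) by (intro card_mono) auto
  with card_image[OF i] show ?thesis by (simp add: vdeg_def)
qed

text \<open>If \<open>u\<close> and \<open>w\<close> both missed \<open>b\<close>, then by the Kempe
  argument \<open>u\<close>, \<open>w\<close> and \<open>y\<close> would lie in one component of the
  edges colored \<open>a\<close> or \<open>b\<close>. All three would have degree at most 1 there,
  but such a component is a path or a cycle.\<close>

lemma vizing_fan_disjoint:
  assumes fin: "finite E" and two: "\<forall>e\<in>E. card e = 2" and nc: "\<not> edge_colorable E k"
    and yx: "{y, x} \<in> E" and E0: "E0 = E - {{y, x}}"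
    and P: "proper_edge_coloring E0 k c"
    and u: "(x, u) \<in> (fan_step E0 k c y)\<^sup>*" and w: "(x, w) \<in> (fan_step E0 k c y)\<^sup>*"
    and a: "a \<in> missing E0 k c y" and "u \<noteq> w"
  shows "missing E0 k c u \<inter> missing E0 k c w = {}"
proof (rule ccontr)
  assume "\<not> ?thesis"
  then obtain b where b: "b \<in> missing E0 k c u" "b \<in> missing E0 k c w" by blast
  let ?H = "{e \<in> E0. c e \<in> {a, b}}"
  let ?r = "{(v, w). {v, w} \<in> ?H}"
  have "sym ?r" by (auto simp: sym_def insert_commute)
  then have symr: "sym (?r\<^sup>*)" by (rule sym_rtrancl)
  have c: "(u, y) \<in> ?r\<^sup>*" "(w, y) \<in> ?r\<^sup>*"
    by (rule vizing_fan_kempe[OF two nc yx E0 P _ _ a]; use u w b in blast)+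
  have disj: "missing E0 k c z \<inter> missing E0 k c y = {}" if "(x, z) \<in> (fan_step E0 k c y)\<^sup>*" for z
    using fan_missing_disjoint[OF two nc yx] P that unfolding E0 by blast
  have bich: "vdeg ?H v \<le> card ({a, b} - missing E0 k c v)" for v
    by (rule bichromatic_vdeg[OF P]) simp
  have le1: "vdeg ?H v \<le> 1" if "a \<in> missing E0 k c v \<or> b \<in> missing E0 k c v" for v
  proof -
    have "card ({a, b} - missing E0 k c v) \<le> card {if a \<in> missing E0 k c v then b else a}"
      by (rule card_mono) (use that in auto)
    with bich[of v] show ?thesis by simp
  qed
  show False
  proof (rule three_ends_not_connected[of ?H u y w])
    show "vdeg ?H v \<le> 2" for v
      using bich[of v] card_mono[of "{a, b}" "{a, b} - missing E0 k c v"] card_insert_le_m1[of 2 "{b}" a]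
      by fastforce
    show "u \<in> ?r\<^sup>* `` {y}" "w \<in> ?r\<^sup>* `` {y}" using c symr by (auto dest: symD)
    show "y \<noteq> u" "y \<noteq> w" using disj u w b by blast+
  qed (use fin two E0 le1 a b \<open>u \<noteq> w\<close> in auto)
qed

text \<open>Every color missing at a vertex of the maximal fan occurs at \<open>y\<close>, on an
  edge to another fan vertex. The missing sets are disjoint, so the fan vertices other than
  \<open>x\<close> are as many as all missing colors together: \<open>k + 1 - vdeg E x\<close> at
  \<open>x\<close> and at least one at each vertex of degree below \<open>k\<close>. The fan
  vertices of degree \<open>k\<close> must make up for those at \<open>x\<close>.\<close>

theorem vizing_adjacency:
  assumes fin: "finite E" and two: "\<forall>e\<in>E. card e = 2" and nc: "\<not> edge_colorable E k"
    and yx: "{y, x} \<in> E" and crit: "edge_colorable (E - {{y, x}}) k"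
    and deg: "\<And>v. vdeg E v \<le> k"
  shows "k + 1 \<le> vdeg E x + card {z. {y, z} \<in> E \<and> z \<noteq> x \<and> vdeg E z = k}"
proof -
  define E0 where "E0 = E - {{y, x}}"
  obtain c where P: "proper_edge_coloring E0 k c"
    using crit by (auto simp: edge_colorable_def E0_def)
  define M where "M = missing E0 k c"
  define X where "X = (fan_step E0 k c y)\<^sup>* `` {x}"
  have finE0: "finite E0" using fin by (simp add: E0_def)
  have yne: "y \<noteq> z" if "{y, z} \<in> E" for z
    using two that by fastforce
  have nbr: "{y, z} \<in> E0" if "z \<in> X - {x}" for z
    using that by (auto simp: X_def fan_step_def elim: rtranclE)
  have nbrE: "{y, z} \<in> E" if "z \<in> X" for z
    using that nbr[of z] yx by (cases "z = x") (auto simp: E0_def)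
  have vdegE0: "vdeg E0 v = vdeg E v - (if v \<in> {y, x} then 1 else 0)" for v
  proof -
    have "{e \<in> E0. v \<in> e} = (if v \<in> {y, x} then {e \<in> E. v \<in> e} - {{y, x}} else {e \<in> E. v \<in> e})"
      by (auto simp: E0_def)
    then show ?thesis using fin yx by (auto simp: vdeg_def)
  qed
  have pos: "vdeg E v > 0" if "v \<in> {y, x}" for v
    using that fin yx by (auto simp: vdeg_def card_gt_0_iff)
  have cM: "card (M v) + vdeg E0 v = k" for v
    unfolding M_def by (rule card_missing[OF finE0 P])
  have "M y \<noteq> {}"
    using cM[of y] vdegE0[of y] pos[of y] deg[of y] by auto
  then obtain a where a: "a \<in> M y" by blast
  have finU: "finite (\<Union>E)" by (rule finite_Union[OF fin]) (use two in \<open>auto intro!: card_ge_0_finite\<close>)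
  have finX: "finite X" using nbrE by (intro finite_subset[OF _ finU]) auto
  have xX: "x \<in> X" by (simp add: X_def)
  have disj: "M u \<inter> M w = {}" if "u \<in> X" "w \<in> X" "u \<noteq> w" for u w
    using vizing_fan_disjoint[OF fin two nc yx E0_def P, of u w a] that a unfolding M_def X_def by blast
  have disjy: "M u \<inter> M y = {}" if "u \<in> X" for u
    using fan_missing_disjoint[OF two nc yx, of c u] P that unfolding M_def X_def E0_def by blast
  define D where "D = X - {x}"
  have bij: "(\<lambda>w. c {y, w}) ` D = (\<Union>u\<in>X. M u)"
  proof (intro equalityI subsetI)
    fix i assume "i \<in> (\<lambda>w. c {y, w}) ` D"
    then obtain w where w: "w \<in> X" "w \<noteq> x" "i = c {y, w}" by (auto simp: D_def)
    then obtain u where "(x, u) \<in> (fan_step E0 k c y)\<^sup>*" "(u, w) \<in> fan_step E0 k c y"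
      by (auto simp: X_def elim: rtranclE)
    then show "i \<in> (\<Union>u\<in>X. M u)" using w by (auto simp: X_def M_def fan_step_def)
  next
    fix i assume "i \<in> (\<Union>u\<in>X. M u)"
    then obtain u where u: "u \<in> X" "i \<in> M u" by blast
    then have "i \<notin> M y" using disjy by blast
    moreover have "i \<in> {1..k}" using u by (auto simp: M_def missing_def)
    ultimately obtain e where e: "e \<in> E0" "y \<in> e" "i = c e" by (auto simp: M_def missing_def)
    have "card e = 2" using e(1) two E0_def by blast
    then obtain p q where "e = {p, q}" by (meson card_2_iff)
    then obtain w where w: "e = {y, w}" using e(2) by (auto simp: insert_commute)
    have "(u, w) \<in> fan_step E0 k c y" using e w u by (simp add: fan_step_def M_def)
    then have "w \<in> X" using u by (auto simp: X_def intro: rtrancl_into_rtrancl)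
    moreover have "w \<noteq> x" using e w by (auto simp: E0_def)
    ultimately show "i \<in> (\<lambda>w. c {y, w}) ` D" using e w by (auto simp: D_def)
  qed
  have inj: "inj_on (\<lambda>w. c {y, w}) D"
  proof (rule inj_onI)
    fix v w assume vw: "v \<in> D" "w \<in> D" "c {y, v} = c {y, w}"
    then have "{y, v} = {y, w}"
      using nbr by (intro proper_edge_coloringD[OF P, of _ _ y]) (auto simp: D_def)
    then show "v = w" by (auto simp: doubleton_eq_iff)
  qed
  have "card D = card (\<Union>u\<in>X. M u)"
    using card_image[OF inj] bij by simp
  also have "\<dots> = (\<Sum>u\<in>X. card (M u))"
    using disj finX by (intro card_UN_disjoint) (auto simp: M_def missing_def)
  also have "\<dots> = card (M x) + (\<Sum>u\<in>D. card (M u))"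
    unfolding D_def by (rule sum.remove[OF finX xX])
  finally have 1: "card D = card (M x) + (\<Sum>u\<in>D. card (M u))" .
  \<comment> \<open>The additional 1 is due to the uncolored edge at \<open>x\<close>.\<close>
  have 2: "card (M x) + vdeg E x = k + 1"
    using cM[of x] vdegE0[of x] pos[of x] by auto
  have cD: "card (M u) + vdeg E u = k" if "u \<in> D" for u
    using cM[of u] vdegE0[of u] that yne[OF nbrE, of u] by (auto simp: D_def)
  have finD: "finite D" using finX by (simp add: D_def)
  have "card {u \<in> D. vdeg E u \<noteq> k} = (\<Sum>u\<in>D. if vdeg E u \<noteq> k then 1 else 0)"
    using finD by (simp add: sum.If_cases Int_def)
  also have "\<dots> \<le> (\<Sum>u\<in>D. card (M u))"
    using cD by (intro sum_mono) force
  finally have 3: "card {u \<in> D. vdeg E u \<noteq> k} \<le> (\<Sum>u\<in>D. card (M u))" .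
  have "card D = card {u \<in> D. vdeg E u = k} + card {u \<in> D. vdeg E u \<noteq> k}"
    using finD by (subst card_Un_disjoint[symmetric]) (auto intro: arg_cong[where f = card])
  with 1 2 3 have "k + 1 \<le> vdeg E x + card {u \<in> D. vdeg E u = k}" by linarith
  also have "card {u \<in> D. vdeg E u = k} \<le> card {z. {y, z} \<in> E \<and> z \<noteq> x \<and> vdeg E z = k}"
  proof (rule card_mono)
    show "finite {z. {y, z} \<in> E \<and> z \<noteq> x \<and> vdeg E z = k}"
      by (rule finite_subset[OF _ finU]) auto
  qed (use nbrE in \<open>auto simp: D_def\<close>)
  finally show ?thesis by simp
qed

section \<open>The average degree of critical graphs\<close>

definition nbrs :: "'a set set \<Rightarrow> 'a \<Rightarrow> 'a set" where
  "nbrs E x = {y. {x, y} \<in> E}"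

lemma card_nbrs:
  assumes "\<forall>e\<in>E. card e = 2"
  shows "card (nbrs E x) = vdeg E x"
  unfolding vdeg_def
proof (rule bij_betw_same_card)
  show "bij_betw (\<lambda>y. {x, y}) (nbrs E x) {e \<in> E. x \<in> e}"
    unfolding bij_betw_def
  proof (intro conjI equalityI subsetI)
    show "inj_on (\<lambda>y. {x, y}) (nbrs E x)" by (auto simp: inj_on_def doubleton_eq_iff)
    fix e assume e: "e \<in> {e \<in> E. x \<in> e}"
    then have "card e = 2" using assms by blast
    then obtain p q where "e = {p, q}" by (meson card_2_iff)
    then obtain w where "e = {x, w}" using e by (auto simp: insert_commute)
    then show "e \<in> (\<lambda>y. {x, y}) ` nbrs E x" using e by (auto simp: nbrs_def)
  qed (auto simp: nbrs_def)
qed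

lemma finite_nbrs: "finite (\<Union>E) \<Longrightarrow> finite (nbrs E x)"
  by (rule finite_subset[of _ "\<Union>E"]) (auto simp: nbrs_def)

text \<open>Discharging: a vertex \<open>y\<close> of degree at least 12 hands its surplus \<open>d y - 12\<close> out in equal
  shares to its neighbors of degree less than 12. With \<open>t = k - d y\<close> and \<open>s = d x - 1\<close> for such a
  neighbor \<open>x\<close>, Vizing's adjacency lemma bounds the number of receivers of \<open>y\<close> by \<open>s - t\<close>.\<close>

theorem critical_edges_ge:
  assumes fin: "finite E" and two: "\<forall>e\<in>E. card e = 2" and nc: "\<not> edge_colorable E k"
    and crit: "\<And>e. e \<in> E \<Longrightarrow> edge_colorable (E - {e}) k"
    and deg: "\<And>v. vdeg E v \<le> k" and k: "18 \<le> k"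
  shows "6 * card (\<Union>E) \<le> card E"
proof -
  define d where "d = vdeg E"
  define N where "N = nbrs E"
  define s where "s y = card {x \<in> N y. d x < 12}" for y
  define g where "g y = (real (d y) - 12) / real (s y)" for y
  define V where "V = \<Union>E"
  have finV: "finite V"
    unfolding V_def by (rule finite_Union[OF fin]) (use two in \<open>auto intro!: card_ge_0_finite\<close>)
  have finN: "finite (N x)" for x unfolding N_def by (rule finite_nbrs) (use finV V_def in simp)
  have cN: "card (N x) = d x" for x unfolding N_def d_def by (rule card_nbrs[OF two])
  have Nsym: "y \<in> N x \<longleftrightarrow> x \<in> N y" for x y by (auto simp: N_def nbrs_def insert_commute)
  have dk: "d v \<le> k" for v using deg by (simp add: d_def)
  have val: "k + 1 \<le> d x + card {z \<in> N y. z \<noteq> x \<and> d z = k}" if "x \<in> N y" for x y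
  proof -
    have "{y, x} \<in> E" using that by (simp add: N_def nbrs_def)
    from vizing_adjacency[OF fin two nc this crit[OF this] deg] show ?thesis
      by (simp add: d_def N_def nbrs_def)
  qed
  have A: "s y + (k + 1) \<le> d y + d x" "1 \<le> s y" if "y \<in> N x" "d x < 12" for x y
  proof -
    have x: "x \<in> N y" using that Nsym by blast
    \<comment> \<open>The neighbors of degree \<open>k\<close> supplied by the adjacency lemma are
      not receivers, because \<open>k\<close> exceeds 12; both kinds have to fit into
      \<open>N y\<close>.\<close>
    have "s y + card {z \<in> N y. z \<noteq> x \<and> d z = k} = card ({x \<in> N y. d x < 12} \<union> {z \<in> N y. z \<noteq> x \<and> d z = k})"
      unfolding s_def using finN k by (subst card_Un_disjoint) auto
    also have "\<dots> \<le> card (N y)" using finN by (intro card_mono) auto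
    finally show "s y + (k + 1) \<le> d y + d x" using val[OF x] cN by simp
    have "card {x} \<le> s y" unfolding s_def using finN x that by (intro card_mono) auto
    then show "1 \<le> s y" by simp
  qed
  \<comment> \<open>With \<open>s = d x - 1\<close> and \<open>t = k - d y\<close>, the surplus of
    \<open>y\<close> is at least \<open>6 - t\<close> because \<open>18 \<le> k\<close>, and at most
    \<open>s - t\<close> neighbors share it. The resulting quotient \<open>(6 - t) / (s - t)\<close>
    increases with \<open>t\<close> for \<open>s < 6\<close> and decreases for \<open>s > 6\<close>,
    hence the separate treatment of small degrees.\<close>
  have B: "(6 - (real k - d y)) / (real (d x) - 1 - (real k - d y)) \<le> g y" "1 \<le> real (d x) - 1 - (real k - d y)"
    if "y \<in> N x" "d x < 12" "12 \<le> d y \<or> k \<le> d y + 6" for x y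
  proof -
    have y: "12 \<le> d y" using that k by auto
    have s: "1 \<le> real (s y)" "real (s y) \<le> real (d x) - 1 - (real k - d y)"
      using A[OF that(1,2)] by linarith+
    then show "1 \<le> real (d x) - 1 - (real k - d y)" by linarith
    have "(6 - (real k - d y)) / (real (d x) - 1 - (real k - d y)) \<le> (real (d y) - 12) / (real (d x) - 1 - (real k - d y))"
      using s k by (intro divide_right_mono) auto
    also have "\<dots> \<le> g y"
      unfolding g_def using s y by (intro divide_left_mono mult_pos_pos) auto
    finally show "(6 - (real k - d y)) / (real (d x) - 1 - (real k - d y)) \<le> g y" .
  qed
  have g0: "0 \<le> g y" if "12 \<le> d y" for y
    using that by (simp add: g_def)
  have C: "12 - real (d x) \<le> (\<Sum>y\<in>{y \<in> N x. 12 \<le> d y}. g y)" if x: "x \<in> V" "d x < 12" for x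
  proof -
    define \<sigma> where "\<sigma> = real (d x) - 1"
    define T where "T y = real k - d y" for y
    have T0: "0 \<le> T y" for y using dk[of y] by (simp add: T_def)
    have B': "(6 - T y) / (\<sigma> - T y) \<le> g y" "1 \<le> \<sigma> - T y"
      if "y \<in> N x" "12 \<le> d y \<or> k \<le> d y + 6" for y
      using B[OF that(1) x(2) that(2)] by (simp_all add: \<sigma>_def T_def)
    obtain y0 where y0: "y0 \<in> N x"
    proof -
      obtain e where e: "e \<in> E" "x \<in> e" using x by (auto simp: V_def)
      then have "card {e \<in> E. x \<in> e} > 0" using fin by (auto simp: card_gt_0_iff)
      then have "card (N x) > 0" using cN by (simp add: d_def vdeg_def)
      then show thesis using that by (auto simp: card_gt_0_iff)
    qed
    have s1: "1 \<le> \<sigma>" "d x \<ge> 2"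
      using A[OF y0 x(2)] dk[of y0] by (simp_all add: \<sigma>_def)
    have sumge: "real (card F) * c \<le> (\<Sum>y\<in>{y \<in> N x. 12 \<le> d y}. g y)"
      if "F \<subseteq> {y \<in> N x. 12 \<le> d y}" "\<And>y. y \<in> F \<Longrightarrow> c \<le> g y" for F c
    proof -
      have "real (card F) * c \<le> sum g F" using that(2) by (rule sum_bounded_below)
      also have "\<dots> \<le> (\<Sum>y\<in>{y \<in> N x. 12 \<le> d y}. g y)"
        using that(1) finN g0 by (intro sum_mono2) auto
      finally show ?thesis .
    qed
    \<comment> \<open>A neighbor of degree at most \<open>k - 4\<close> forces five neighbors of
      degree \<open>k\<close>. Five shares of \<open>6 / 7\<close> cover the 4 that a vertex of
      degree 8 lacks; four shares would not.\<close>
    consider "d x \<le> 7" | "8 \<le> d x" "\<exists>z\<in>N x. d z + 4 \<le> k" | "8 \<le> d x" "\<forall>z\<in>N x. k \<le> d z + 3"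
      by force
    then show ?thesis
    proof cases
      case 1
      have near: "k \<le> d y + 5" if "y \<in> N x" for y
        using A[OF that x(2)] 1 by linarith
      have "6 / \<sigma> \<le> g y" if "y \<in> N x" for y
      proof -
        have "6 / \<sigma> \<le> (6 - T y) / (\<sigma> - T y)"
        proof -
          have "\<sigma> \<le> 6" using 1 by (simp add: \<sigma>_def)
          then have "\<sigma> * T y \<le> 6 * T y" using T0 by (intro mult_right_mono) auto
          then show ?thesis
            using B'(2)[OF that] near[OF that] s1 by (simp add: divide_simps algebra_simps)
        qed
        with B'(1)[OF that] near[OF that] show ?thesis by linarith
      qed
      then have "real (card (N x)) * (6 / \<sigma>) \<le> (\<Sum>y\<in>{y \<in> N x. 12 \<le> d y}. g y)"
        using near k by (intro sumge) force+
      \<comment> \<open>Equality holds for degrees 3 and 4.\<close>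
      moreover have "12 - real (d x) \<le> real (card (N x)) * (6 / \<sigma>)"
      proof -
        have "d x \<in> {2,3,4,5,6,7}" using 1 s1 by auto
        then show ?thesis unfolding cN \<sigma>_def by (auto simp: field_simps)
      qed
      ultimately show ?thesis by linarith
    next
      case 2
      then obtain z where z: "z \<in> N x" "d z + 4 \<le> k" by blast
      define F where "F = {y \<in> N x. y \<noteq> z \<and> d y = k}"
      have cF: "5 \<le> card F" using val[OF z(1)] z(2) by (simp add: F_def)
      have "real (card F) * (6 / \<sigma>) \<le> (\<Sum>y\<in>{y \<in> N x. 12 \<le> d y}. g y)"
      proof (rule sumge)
        fix y assume y: "y \<in> F"
        then have "T y = 0" by (simp add: F_def T_def)
        then show "6 / \<sigma> \<le> g y" using B'(1)[of y] y by (simp add: F_def)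
      qed (use k in \<open>auto simp: F_def\<close>)
      moreover have "5 * (6 / \<sigma>) \<le> real (card F) * (6 / \<sigma>)"
        using cF s1 by (intro mult_right_mono) auto
      moreover have "12 - real (d x) \<le> 5 * (6 / \<sigma>)"
      proof -
        have "d x \<in> {8,9,10,11}" using 2 x by auto
        then show ?thesis unfolding \<sigma>_def by auto
      qed
      ultimately show ?thesis by linarith
    next
      case 3
      have s7: "7 \<le> \<sigma>" using 3 by (simp add: \<sigma>_def)
      have "3 / (\<sigma> - 3) \<le> g y" if "y \<in> N x" for y
      proof -
        have near: "k \<le> d y + 3" using 3 that by blast
        then have T3: "T y \<le> 3" by (simp add: T_def)
        have "3 / (\<sigma> - 3) \<le> (6 - T y) / (\<sigma> - T y)"
        proof -
          have "0 \<le> (3 - T y) * (\<sigma> - 6)" using T3 s7 by simp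
          then show ?thesis using T3 s7 by (simp add: divide_simps algebra_simps)
        qed
        with B'(1)[OF that] near show ?thesis by linarith
      qed
      then have "real (card (N x)) * (3 / (\<sigma> - 3)) \<le> (\<Sum>y\<in>{y \<in> N x. 12 \<le> d y}. g y)"
        using 3 k by (intro sumge) force+
      moreover have "12 - real (d x) \<le> real (card (N x)) * (3 / (\<sigma> - 3))"
      proof -
        have "d x \<in> {8,9,10,11}" using 3 x by auto
        then show ?thesis unfolding \<sigma>_def cN by auto
      qed
      ultimately show ?thesis by linarith
    qed
  qed
  define S where "S = {x \<in> V. d x < 12}"
  define L where "L = {x \<in> V. 12 \<le> d x}"
  have fSL: "finite S" "finite L" using finV by (auto simp: S_def L_def)
  have NV: "N x \<subseteq> V" for x by (auto simp: N_def nbrs_def V_def)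
  have "(\<Sum>x\<in>S. 12 - real (d x)) \<le> (\<Sum>x\<in>S. \<Sum>y\<in>{y \<in> N x. 12 \<le> d y}. g y)"
    using C by (intro sum_mono) (auto simp: S_def)
  also have "\<dots> = (\<Sum>x\<in>S. \<Sum>y\<in>{y. y \<in> L \<and> y \<in> N x}. g y)"
    using NV by (intro sum.cong refl) (auto simp: L_def)
  also have "\<dots> = (\<Sum>y\<in>L. \<Sum>x\<in>{x. x \<in> S \<and> y \<in> N x}. g y)"
    using fSL by (rule sum.swap_restrict)
  also have "\<dots> = (\<Sum>y\<in>L. real (s y) * g y)"
  proof (intro sum.cong refl)
    fix y
    have "{x. x \<in> S \<and> y \<in> N x} = {x \<in> N y. d x < 12}"
      using NV Nsym by (auto simp: S_def)
    then show "(\<Sum>x\<in>{x. x \<in> S \<and> y \<in> N x}. g y) = real (s y) * g y" by (simp add: s_def)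
  qed
  \<comment> \<open>Equality, unless \<open>y\<close> has no receivers; then \<open>g y\<close> is a
    division by zero and has the value 0.\<close>
  also have "\<dots> \<le> (\<Sum>y\<in>L. real (d y) - 12)"
    by (intro sum_mono) (auto simp: g_def L_def)
  finally have "0 \<le> (\<Sum>x\<in>S. real (d x) - 12) + (\<Sum>y\<in>L. real (d y) - 12)"
    by (simp add: sum_subtractf)
  also have "\<dots> = (\<Sum>x\<in>V. real (d x) - 12)"
    unfolding S_def L_def using finV
    by (subst sum.union_disjoint[symmetric]) (auto intro!: sum.cong)
  also have "\<dots> = real (\<Sum>x\<in>V. d x) - 12 * real (card V)"
    by (simp add: sum_subtractf)
  also have "(\<Sum>x\<in>V. d x) = 2 * card E"
    unfolding d_def using fin two finV by (intro sum_vdeg) (auto simp: V_def)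
  finally show ?thesis by (simp add: V_def)
qed

section \<open>Splitting vertices\<close>

text \<open>Every vertex \<open>v\<close> is split into copies \<open>(v, j)\<close>, each with \<open>k\<close> of the edges at \<open>v\<close>, except
  for the last one, which gets the remaining fewer than \<open>k\<close> edges. In a proper coloring with \<open>k\<close>
  colors every color occurs exactly once at a copy with \<open>k\<close> edges.\<close>

lemma vertex_splitting:
  assumes fin: "finite E" and two: "\<forall>e\<in>E. card e = 2" and k: "0 < k"
  obtains \<sigma> :: "'a set \<Rightarrow> ('a \<times> nat) set"
  where "\<And>e. e \<in> E \<Longrightarrow> card (\<sigma> e) = 2" "\<And>e. fst ` \<sigma> e = e"
    and "\<And>v. vdeg (\<sigma> ` E) v \<le> k"
    and "edge_colorable (\<sigma> ` E) k \<Longrightarrow> \<exists>\<phi>. equitable_edge_coloring V E k \<phi>"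
proof -
  have "\<exists>h. bij_betw h {e \<in> E. v \<in> e} {0..<vdeg E v}" for v
    unfolding vdeg_def using fin by (intro ex_bij_betw_finite_nat) auto
  then obtain num where num: "\<And>v. bij_betw (num v) {e \<in> E. v \<in> e} {0..<vdeg E v}" by metis
  define \<sigma> where "\<sigma> e = (\<lambda>v. (v, num v e div k)) ` e" for e
  define B where "B v j = {e \<in> E. v \<in> e \<and> num v e div k = j}" for v j
  have fst\<sigma>: "fst ` \<sigma> e = e" for e by (force simp: \<sigma>_def)
  have card\<sigma>: "card (\<sigma> e) = card e" for e
    unfolding \<sigma>_def by (rule card_image) (auto simp: inj_on_def)
  have inj\<sigma>: "inj_on \<sigma> A" for A by (metis fst\<sigma> inj_onI)
  have mem: "(v, j) \<in> \<sigma> e \<longleftrightarrow> v \<in> e \<and> num v e div k = j" for v j e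
    by (auto simp: \<sigma>_def)
  have block: "{n. n div k = j} = {j * k..<j * k + k}" for j
  proof (intro set_eqI iffI; simp)
    fix n
    assume "n div k = j"
    then show "j * k \<le> n \<and> n < j * k + k"
      using div_mult_mod_eq[of n k] mod_less_divisor[OF k, of n] by auto
  next
    fix n
    assume "j * k \<le> n \<and> n < j * k + k"
    then show "n div k = j" using k
      by (intro div_nat_eqI) (auto simp: algebra_simps)
  qed
  have numB: "num v ` B v j = {0..<vdeg E v} \<inter> {j * k..<j * k + k}" for v j
  proof -
    have "num v ` B v j = num v ` {e \<in> E. v \<in> e} \<inter> {n. n div k = j}"
      by (auto simp: B_def)
    then show ?thesis using num[of v] by (simp add: bij_betw_def block)
  qed
  have cardB: "card (B v j) = card ({0..<vdeg E v} \<inter> {j * k..<j * k + k})" for v j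
  proof -
    have "inj_on (num v) (B v j)"
      using num[of v] by (auto simp: bij_betw_def B_def intro: inj_on_subset)
    from card_image[OF this] numB show ?thesis by simp
  qed
  have Ble: "card (B v j) \<le> k" for v j
    unfolding cardB using card_mono[of "{j * k..<j * k + k}"] by auto
  have Bfull: "card (B v j) = k" if "j < vdeg E v div k" for v j
  proof -
    have "Suc j * k \<le> vdeg E v div k * k" using that by (intro mult_right_mono) auto
    also have "\<dots> \<le> vdeg E v" by simp
    finally have "{0..<vdeg E v} \<inter> {j * k..<j * k + k} = {j * k..<j * k + k}" by auto
    then show ?thesis unfolding cardB by simp
  qed
  have deg: "vdeg (\<sigma> ` E) v \<le> k" for v
  proof -
    obtain u j where v: "v = (u, j)" by (cases v)
    have "{f \<in> \<sigma> ` E. v \<in> f} = \<sigma> ` B u j"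
      by (auto simp: v mem B_def)
    then show ?thesis unfolding vdeg_def using card_image[OF inj\<sigma>] Ble by simp
  qed
  have eq: "\<exists>\<phi>. equitable_edge_coloring V E k \<phi>" if colorable: "edge_colorable (\<sigma> ` E) k"
  proof -
    obtain c where "proper_edge_coloring (\<sigma> ` E) k c"
      using colorable unfolding edge_colorable_def by blast
    then have c: "c ` \<sigma> ` E \<subseteq> {1..k}" "\<And>v. inj_on c {f \<in> \<sigma> ` E. v \<in> f}"
      unfolding proper_edge_coloring_def by auto
    define \<phi> where "\<phi> e = c (\<sigma> e)" for e
    have injB: "inj_on \<phi> (B v j)" for v j
    proof -
      have "inj_on c (\<sigma> ` B v j)"
        by (rule inj_on_subset[OF c(2)[of "(v, j)"]]) (auto simp: mem B_def)
      then have "inj_on (c \<circ> \<sigma>) (B v j)" using inj\<sigma> by (rule comp_inj_on[rotated])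
      then show ?thesis by (simp add: comp_def \<phi>_def[abs_def])
    qed
    have rng: "\<phi> ` B v j \<subseteq> {1..k}" for v j
      using c(1) by (auto simp: \<phi>_def B_def)
    have le1: "card {e \<in> B v j. \<phi> e = i} \<le> 1" for v j i
    proof -
      have "finite {e \<in> B v j. \<phi> e = i}" using fin by (auto simp: B_def)
      then show ?thesis
        using injB[of v j] by (auto simp: card_le_Suc0_iff_eq inj_on_def)
    qed
    have eq1: "card {e \<in> B v j. \<phi> e = i} = 1" if "j < vdeg E v div k" "i \<in> {1..k}" for v j i
    proof -
      have "card (\<phi> ` B v j) = k" using card_image[OF injB] Bfull[OF that(1)] by simp
      then have "\<phi> ` B v j = {1..k}" using card_subset_eq[OF _ rng] by simp
      then have "i \<in> \<phi> ` B v j" using that(2) by simp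
      then have "{e \<in> B v j. \<phi> e = i} \<noteq> {}" by blast
      moreover have "finite {e \<in> B v j. \<phi> e = i}" using fin by (auto simp: B_def)
      ultimately have "card {e \<in> B v j. \<phi> e = i} > 0" by (simp add: card_gt_0_iff)
      with le1[of v j i] show ?thesis by linarith
    qed
    \<comment> \<open>With \<open>q = vdeg E v div k\<close>, the blocks below \<open>q\<close> are
      full and contain each color once. Block \<open>q\<close> is partial, possibly empty, and
      contains it at most once.\<close>
    have cd: "vdeg E v div k \<le> color_degree E \<phi> i v \<and> color_degree E \<phi> i v \<le> vdeg E v div k + 1"
      if "i \<in> {1..k}" for v i
    proof -
      let ?q = "vdeg E v div k"
      have "num v e div k \<le> ?q" if "e \<in> E" "v \<in> e" for e
      proof -
        have "num v e \<in> {0..<vdeg E v}" using num[of v] that by (auto simp: bij_betw_def)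
        then show ?thesis by (intro div_le_mono) auto
      qed
      then have "{e \<in> E. v \<in> e \<and> \<phi> e = i} = (\<Union>j\<in>{..?q}. {e \<in> B v j. \<phi> e = i})"
        by (auto simp: B_def)
      then have "color_degree E \<phi> i v = card (\<Union>j\<in>{..?q}. {e \<in> B v j. \<phi> e = i})"
        by (simp add: color_degree_def)
      also have "\<dots> = (\<Sum>j\<in>{..?q}. card {e \<in> B v j. \<phi> e = i})"
        using fin by (intro card_UN_disjoint) (auto simp: B_def)
      also have "\<dots> = (\<Sum>j<?q. card {e \<in> B v j. \<phi> e = i}) + card {e \<in> B v ?q. \<phi> e = i}"
        by (simp add: lessThan_Suc_atMost[symmetric])
      also have "(\<Sum>j<?q. card {e \<in> B v j. \<phi> e = i}) = ?q"
        using eq1 that by simp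
      finally show ?thesis using le1[of v ?q i] by linarith
    qed
    have "equitable_edge_coloring V E k \<phi>"
      unfolding equitable_edge_coloring_def edge_coloring_def
    proof (intro conjI ballI allI impI)
      show "\<phi> ` E \<subseteq> {1..k}" using c(1) by (auto simp: \<phi>_def)
      fix v i j assume "1 \<le> i \<and> i < j \<and> j \<le> k"
      then show "\<bar>int (color_degree E \<phi> i v) - int (color_degree E \<phi> j v)\<bar> \<le> 1"
        using cd[of i v] cd[of j v] by auto
    qed
    then show ?thesis by blast
  qed
  show thesis
    by (rule that[of \<sigma>]) (use card\<sigma> two fst\<sigma> deg eq in auto)
qed

theorem equitable_edge_coloring_if_sparse:
  assumes fin: "finite E" and two: "\<forall>e\<in>E. card e = 2" and k: "18 \<le> k"
    and sparse: "\<And>F. F \<subseteq> E \<Longrightarrow> F \<noteq> {} \<Longrightarrow> card F < 6 * card (\<Union>F)"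
  shows "\<exists>\<phi>. equitable_edge_coloring V E k \<phi>"
proof (rule ccontr)
  assume no: "\<not> ?thesis"
  have "0 < k" using k by simp
  then obtain \<sigma> :: "'a set \<Rightarrow> ('a \<times> nat) set" where \<sigma>: "\<And>e. e \<in> E \<Longrightarrow> card (\<sigma> e) = 2"
      "\<And>e. fst ` \<sigma> e = e" "\<And>v. vdeg (\<sigma> ` E) v \<le> k"
      "edge_colorable (\<sigma> ` E) k \<Longrightarrow> \<exists>\<phi>. equitable_edge_coloring V E k \<phi>"
    using vertex_splitting[OF fin two, of k V] by blast
  define Q where "Q S \<longleftrightarrow> S \<subseteq> \<sigma> ` E \<and> \<not> edge_colorable S k" for S
  have "Q (\<sigma> ` E)" using no \<sigma>(4) by (auto simp: Q_def)
  \<comment> \<open>An uncolorable set of least cardinality becomes colorable when any edge is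
    removed, so it is critical.\<close>
  then obtain S where S: "Q S" and min: "\<And>T. Q T \<Longrightarrow> card S \<le> card T"
    using ex_has_least_nat[of Q _ card] by blast
  have finS: "finite S" using S fin by (auto simp: Q_def intro: finite_subset)
  have crit: "edge_colorable (S - {e}) k" if "e \<in> S" for e
  proof (rule ccontr)
    assume "\<not> ?thesis"
    then have "Q (S - {e})" using S by (auto simp: Q_def)
    from min[OF this] show False using card_Diff1_less[OF finS that] by simp
  qed
  have degS: "vdeg S v \<le> k" for v
  proof -
    have "vdeg S v \<le> vdeg (\<sigma> ` E) v"
      unfolding vdeg_def using S fin by (intro card_mono) (auto simp: Q_def)
    with \<sigma>(3)[of v] show ?thesis by linarith
  qed
  have twoS: "\<forall>e\<in>S. card e = 2" using S \<sigma>(1) by (auto simp: Q_def)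
  have ge: "6 * card (\<Union>S) \<le> card S"
    by (rule critical_edges_ge[OF finS twoS _ crit degS k]) (use S in \<open>auto simp: Q_def\<close>)
  obtain F where F: "F \<subseteq> E" "S = \<sigma> ` F" using S by (auto simp: Q_def subset_image_iff)
  have "S \<noteq> {}"
    using S by (auto simp: Q_def edge_colorable_def proper_edge_coloring_def)
  then have "card F < 6 * card (\<Union>F)" using sparse F by blast
  \<comment> \<open>\<open>S\<close> is an image of \<open>F\<close> under splitting, and
    \<open>fst\<close> maps its vertices onto those of \<open>F\<close>; hence \<open>F\<close> is
    at least as dense as \<open>S\<close>.\<close>
  moreover have "card S \<le> card F" using F fin by (auto intro: card_image_le finite_subset)
  moreover have "card (\<Union>F) \<le> card (\<Union>S)"
  proof -
    have "\<Union>F = fst ` (\<Union>S)" by (simp add: F(2) image_UN \<sigma>(2))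
    moreover have "finite (\<Union>S)"
      by (rule finite_Union[OF finS]) (use twoS in \<open>auto intro!: card_ge_0_finite\<close>)
    ultimately show ?thesis by (simp add: card_image_le)
  qed
  ultimately show False using ge by linarith
qed

section \<open>The number of edges of a plane graph\<close>

lemma connected_inside_or_outside:
  fixes S J :: "'a::real_normed_vector set"
  assumes "connected S" "S \<inter> J = {}"
  shows "S \<subseteq> inside J \<or> S \<subseteq> outside J"
proof (rule ccontr)
  assume "\<not> ?thesis"
  then obtain x y where xy: "x \<in> S" "x \<notin> outside J" "y \<in> S" "y \<notin> inside J" by blast
  have "x \<in> inside J" using xy(1,2) assms(2) inside_Un_outside[of J] by blast
  moreover have "connected_component (- J) x y"
    unfolding connected_component_def using assms xy by (intro exI[of _ S]) auto
  ultimately show False using inside_same_component xy(4) by blast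
qed

lemma join_arcs_Jordan:
  fixes g h :: "real \<Rightarrow> complex"
  assumes "arc g" "arc h" "pathstart g = a" "pathfinish g = b" "pathstart h = a" "pathfinish h = b"
    and "path_image g \<inter> path_image h = {a, b}"
  defines "J \<equiv> path_image g \<union> path_image h"
  shows "inside J \<noteq> {}" "connected (inside J)" "bounded (inside J)" "frontier (inside J) = J"
    and "connected (outside J)" "open (outside J)" "compact J"
proof -
  let ?c = "g +++ reversepath h"
  have s: "simple_path ?c"
    by (rule simple_path_join_loop) (use assms in \<open>auto simp: arc_reversepath\<close>)
  have c: "pathfinish ?c = pathstart ?c" using assms by simp
  have J: "path_image ?c = J" using assms by (simp add: path_image_join)
  show "inside J \<noteq> {}" "connected (inside J)" "bounded (inside J)" "frontier (inside J) = J"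
    and "connected (outside J)" "open (outside J)" 
    using Jordan_inside_outside[OF s c] unfolding J by blast+
  show "compact J" unfolding J_def using assms by (simp add: compact_Un compact_arc_image)
qed

text \<open>Each of the two domains is connected and avoids the boundary of the other. If they met,
  each would lie in the other, so they and their frontiers would coincide, which puts
  \<open>B\<close> into \<open>A \<union> C\<close>.\<close>

lemma theta_insides_disjoint:
  fixes A B C :: "complex set"
  assumes AB: "connected (inside (A \<union> B))" "frontier (inside (A \<union> B)) = A \<union> B"
    and AC: "connected (inside (A \<union> C))" "frontier (inside (A \<union> C)) = A \<union> C"
    and "C \<inter> inside (A \<union> B) = {}" "B \<inter> inside (A \<union> C) = {}" "\<not> B \<subseteq> A \<union> C"
  shows "inside (A \<union> B) \<inter> inside (A \<union> C) = {}"
proof (rule ccontr)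
  assume ne: "\<not> ?thesis"
  have "inside (A \<union> B) \<inter> (A \<union> C) = {}" using inside_no_overlap[of "A \<union> B"] assms(5) by blast
  then have 1: "inside (A \<union> B) \<subseteq> inside (A \<union> C)"
    using connected_inside_or_outside[OF AB(1)] ne inside_Int_outside[of "A \<union> C"] by blast
  have "inside (A \<union> C) \<inter> (A \<union> B) = {}" using inside_no_overlap[of "A \<union> C"] assms(6) by blast
  then have 2: "inside (A \<union> C) \<subseteq> inside (A \<union> B)"
    using connected_inside_or_outside[OF AC(1)] ne inside_Int_outside[of "A \<union> B"] by blast
  from 1 2 have "A \<union> B = A \<union> C" using AB(2) AC(2) by (metis subset_antisym)
  with assms(7) show False by blast
qed

text \<open>Otherwise the three inner domains would be disjoint; the complement of two of their closures is
  connected by Janiszewski's theorem and unbounded, but the third domain is clopen in it.\<close>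

lemma theta_some_inside:
  fixes c1 c2 c :: "real \<Rightarrow> complex"
  assumes arcs: "arc c1" "arc c2" "arc c"
    and ends: "pathstart c1 = a" "pathfinish c1 = b" "pathstart c2 = a" "pathfinish c2 = b"
      "pathstart c = a" "pathfinish c = b"
    and int: "path_image c1 \<inter> path_image c2 = {a, b}" "path_image c1 \<inter> path_image c = {a, b}"
      "path_image c2 \<inter> path_image c = {a, b}"
    and out: "path_image c \<inter> inside (path_image c1 \<union> path_image c2) = {}"
  shows "path_image c2 \<inter> inside (path_image c1 \<union> path_image c) \<noteq> {} \<or>
    path_image c1 \<inter> inside (path_image c2 \<union> path_image c) \<noteq> {}"
proof (rule ccontr)
  assume no: "\<not> ?thesis"
  let ?A = "path_image c1" and ?B = "path_image c2" and ?C = "path_image c"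
  note AB = join_arcs_Jordan[OF arcs(1,2) ends(1,2,3,4) int(1)]
  note AC = join_arcs_Jordan[OF arcs(1,3) ends(1,2,5,6) int(2)]
  note BC = join_arcs_Jordan[OF arcs(2,3) ends(3,4,5,6) int(3)]
  have ne: "path_image g - {a, b} \<noteq> {}" if "arc g" "pathstart g = a" "pathfinish g = b" for g :: "real \<Rightarrow> complex"
    using nonempty_simple_path_endless[OF arc_imp_simple_path[OF that(1)]] that(2,3) by simp
  have neA: "\<not> ?A \<subseteq> ?B \<union> ?C" and neB: "\<not> ?B \<subseteq> ?A \<union> ?C" and neC: "\<not> ?C \<subseteq> ?B \<union> ?A"
    using ne[OF arcs(1) ends(1,2)] ne[OF arcs(2) ends(3,4)] ne[OF arcs(3) ends(5,6)] int by blast+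
  have d1: "inside (?A \<union> ?B) \<inter> inside (?A \<union> ?C) = {}"
    by (rule theta_insides_disjoint) (use AB AC out no neB in auto)
  have d2: "inside (?B \<union> ?A) \<inter> inside (?B \<union> ?C) = {}"
    by (rule theta_insides_disjoint) (use AB BC out no neA in \<open>auto simp: Un_commute\<close>)
  have d3: "inside (?C \<union> ?A) \<inter> inside (?C \<union> ?B) = {}"
    by (rule theta_insides_disjoint) (use AC BC out no neA in \<open>auto simp: Un_commute\<close>)
  define K where "K = ?A \<union> ?B \<union> inside (?A \<union> ?B)"
  define L where "L = ?A \<union> ?C \<union> inside (?A \<union> ?C)"
  have K: "- K = outside (?A \<union> ?B)" and L: "- L = outside (?A \<union> ?C)"
    unfolding K_def L_def by (simp_all add: outside_inside)
  have cl: "closed K" "closed L"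
    using AB(6) AC(6) K L by (simp_all add: closed_def)
  have bd: "bounded K" "bounded L"
    unfolding K_def L_def using AB(3) AC(3) AB(7)[THEN compact_imp_bounded] AC(7)[THEN compact_imp_bounded]
    by simp_all
  \<comment> \<open>The two closed discs share only the arc \<open>?A\<close>, so their intersection
    is connected, as Janiszewski's theorem requires.\<close>
  have KL: "K \<inter> L = ?A"
    using d1 out no int inside_no_overlap[of "?A \<union> ?B"] inside_no_overlap[of "?A \<union> ?C"]
      pathstart_in_path_image[of c1] pathfinish_in_path_image[of c1] ends(1,2)
    unfolding K_def L_def by blast
  have W: "connected (- (K \<union> L))"
  proof (rule Janiszewski_connected)
    show "compact K" using cl bd compact_eq_bounded_closed by blast
    show "connected (K \<inter> L)" unfolding KL using arcs(1) by (rule connected_arc_image)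
  qed (use cl AB(5) AC(5) K L in auto)
  have sub: "inside (?B \<union> ?C) \<subseteq> - (K \<union> L)"
  proof -
    have "inside (?A \<union> ?B) \<inter> inside (?B \<union> ?C) = {}" using d2 by (metis Un_commute)
    moreover have "inside (?A \<union> ?C) \<inter> inside (?B \<union> ?C) = {}" using d3 by (metis Un_commute)
    ultimately show ?thesis
      using no inside_no_overlap[of "?B \<union> ?C"] unfolding K_def L_def by blast
  qed
  have "- (K \<union> L) - inside (?B \<union> ?C) \<noteq> {}"
  proof
    assume "- (K \<union> L) - inside (?B \<union> ?C) = {}"
    then have "UNIV \<subseteq> K \<union> L \<union> inside (?B \<union> ?C)" by blast
    then have "bounded (UNIV :: complex set)"
      using bd BC(3) by (meson bounded_Un bounded_subset)
    then show False by (simp add: not_bounded_UNIV)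
  qed
  then have "- (K \<union> L) \<inter> frontier (inside (?B \<union> ?C)) \<noteq> {}"
    using W sub BC(1) by (intro connected_Int_frontier) auto
  then show False unfolding BC(4) K_def L_def by blast
qed

section \<open>Paths and cycles as sets of edges\<close>

fun pedges :: "'a list \<Rightarrow> 'a set set" where
  "pedges (x # y # zs) = insert {x, y} (pedges (y # zs))"
| "pedges _ = {}"

lemma pedges_Cons: "xs \<noteq> [] \<Longrightarrow> pedges (x # xs) = insert {x, hd xs} (pedges xs)"
  by (cases xs) auto

lemma Union_pedges_subset: "\<Union>(pedges xs) \<subseteq> set xs"
  by (induction xs rule: pedges.induct) auto

lemma Union_pedges: "length xs \<ge> 2 \<Longrightarrow> \<Union>(pedges xs) = set xs"
proof (induction xs rule: pedges.induct)
  case (1 x y zs)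
  then show ?case by (cases zs) auto
qed auto

lemma finite_pedges: "finite (pedges xs)"
  by (induction xs rule: pedges.induct) auto

lemma card_pedges: "distinct xs \<Longrightarrow> card (pedges xs) = length xs - 1"
proof (induction xs rule: pedges.induct)
  case (1 x y zs)
  have "{x, y} \<notin> pedges (y # zs)" using Union_pedges_subset[of "y # zs"] 1(2) by auto
  then show ?case using 1 by (simp add: finite_pedges)
qed auto

lemma pedges_append: "pedges (xs @ m # ys) = pedges (xs @ [m]) \<union> pedges (m # ys)"
  by (induction xs rule: pedges.induct) auto

lemma pedges_rev: "pedges (rev xs) = pedges xs"
proof (induction xs rule: pedges.induct)
  case (1 x y zs)
  have "pedges (rev (x # y # zs)) = pedges (rev zs @ y # [x])" by simp
  also have "\<dots> = pedges (rev (y # zs)) \<union> {{y, x}}" by (subst pedges_append) simp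
  finally show ?case using 1 by (auto simp: insert_commute)
qed auto

lemma pedges_ends: "distinct (a # us @ [b]) \<Longrightarrow> {a, b} \<in> pedges (a # us @ [b]) \<Longrightarrow> us = []"
  using Union_pedges_subset[of "us @ [b]"]
  by (cases us) (auto simp: doubleton_eq_iff)

lemma pedges_meets_inner:
  "us \<noteq> [] \<Longrightarrow> f \<in> pedges (a # us @ [b]) \<Longrightarrow> f \<inter> set us \<noteq> {}"
  by (induction us arbitrary: a) (auto simp: pedges_Cons hd_append split: if_splits)

lemma successively_imp_pedges:
  "successively (\<lambda>u v. {u, v} \<in> F) xs \<Longrightarrow> pedges xs \<subseteq> F"
  by (induction xs rule: pedges.induct) auto

text \<open>The edges of a path from \<open>a\<close> to \<open>b\<close> with \<open>m\<close> inner vertices, and of a cycle of length \<open>n\<close>.\<close>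

definition link :: "'a \<Rightarrow> 'a \<Rightarrow> 'a set set \<Rightarrow> nat \<Rightarrow> bool" where
  "link a b D m \<longleftrightarrow> (\<exists>us. distinct (a # us @ [b]) \<and> D = pedges (a # us @ [b]) \<and> length us = m)"

definition cyc :: "'a set set \<Rightarrow> nat \<Rightarrow> bool" where
  "cyc D n \<longleftrightarrow> (\<exists>zs. distinct zs \<and> 3 \<le> n \<and> length zs = n \<and> D = pedges (zs @ [hd zs]))"

lemma link_sym: "link a b D m \<Longrightarrow> link b a D m"
proof -
  assume "link a b D m"
  then obtain us where "distinct (a # us @ [b])" "D = pedges (a # us @ [b])" "length us = m"
    by (auto simp: link_def)
  then show "link b a D m"
    unfolding link_def using pedges_rev[of "a # us @ [b]"] by (intro exI[of _ "rev us"]) auto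
qed

lemma linkD:
  assumes "link a b D m"
  shows "a \<noteq> b" "card D = m + 1" "{a, b} \<subseteq> \<Union>D" "card (\<Union>D - {a, b}) = m" "finite D" "D \<noteq> {}"
    "{a, b} \<in> D \<Longrightarrow> m = 0" "m = 0 \<Longrightarrow> D = {{a, b}}" "finite (\<Union>D)"
proof -
  obtain us where us: "distinct (a # us @ [b])" "D = pedges (a # us @ [b])" "length us = m"
    using assms by (auto simp: link_def)
  have U: "\<Union>D = set (a # us @ [b])" unfolding us by (rule Union_pedges) simp
  show "a \<noteq> b" "{a, b} \<subseteq> \<Union>D" "finite (\<Union>D)" using us U by auto
  show c: "card D = m + 1" using card_pedges[OF us(1)] us by simp
  have "\<Union>D - {a, b} = set us" using U us(1) by auto
  then show "card (\<Union>D - {a, b}) = m" using us by (simp add: distinct_card)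
  show "finite D" using us finite_pedges by simp
  show "D \<noteq> {}" using c by auto
  show "{a, b} \<in> D \<Longrightarrow> m = 0" using pedges_ends us by force
  show "m = 0 \<Longrightarrow> D = {{a, b}}" using us by simp
qed

text \<open>The condition on \<open>m1 + m2\<close> excludes that both links are the single edge
  \<open>{a, b}\<close>; otherwise one runs from \<open>a\<close> to \<open>b\<close> and the other
  back.\<close>

lemma cyc_join:
  assumes 1: "link a b D1 m1" and 2: "link a b D2 m2" and int: "\<Union>D1 \<inter> \<Union>D2 = {a, b}"
    and "1 \<le> m1 + m2"
  shows "cyc (D1 \<union> D2) (m1 + m2 + 2)"
proof -
  obtain us where us: "distinct (a # us @ [b])" "D1 = pedges (a # us @ [b])" "length us = m1"
    using 1 by (auto simp: link_def)
  obtain ws where ws: "distinct (b # ws @ [a])" "D2 = pedges (b # ws @ [a])" "length ws = m2"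
    using link_sym[OF 2] by (auto simp: link_def)
  have U: "\<Union>D1 = set (a # us @ [b])" "\<Union>D2 = set (b # ws @ [a])"
    unfolding us ws by (rule Union_pedges; simp)+
  let ?zs = "a # us @ b # ws"
  have "distinct ?zs" using us ws int unfolding U by auto
  moreover have "D1 \<union> D2 = pedges (?zs @ [hd ?zs])"
    using pedges_append[of "a # us" b "ws @ [a]"] us ws by simp
  ultimately show ?thesis unfolding cyc_def using us ws assms(4) by (intro exI[of _ ?zs]) auto
qed

lemma cyc_split:
  assumes "cyc D n" and ab: "a \<in> \<Union>D" "b \<in> \<Union>D" "a \<noteq> b"
  obtains D1 D2 m1 m2 where "link a b D1 m1" "link a b D2 m2" "\<Union>D1 \<inter> \<Union>D2 = {a, b}"
    "D = D1 \<union> D2" "n = m1 + m2 + 2" "D1 \<inter> D2 = {}"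
proof -
  obtain zs where zs: "distinct zs" "3 \<le> n" "length zs = n" "D = pedges (zs @ [hd zs])"
    using assms(1) by (auto simp: cyc_def)
  have ne: "zs \<noteq> []" using zs by auto
  have "\<Union>D = set (zs @ [hd zs])" unfolding zs(4) by (rule Union_pedges) (use zs in auto)
  then have U: "\<Union>D = set zs" using ne by auto
  then obtain xs ys where xy: "zs = xs @ a # ys" using ab(1) by (metis split_list)
  \<comment> \<open>The cycle is rotated so that it starts and ends at \<open>a\<close>; then it
    only has to be cut at \<open>b\<close>.\<close>
  have D: "D = pedges (a # (ys @ xs) @ [a])"
  proof (cases xs)
    case Nil
    then show ?thesis using zs(4) xy by simp
  next
    case (Cons x xs')
    have "D = pedges (xs @ a # (ys @ [x]))" using zs(4) xy Cons by simp
    also have "\<dots> = pedges (xs @ [a]) \<union> pedges (a # ys @ [x])"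
      by (rule pedges_append)
    also have "\<dots> = pedges ((a # ys) @ x # (xs' @ [a]))"
      using pedges_append[of "a # ys" x "xs' @ [a]"] Cons by auto
    finally show ?thesis using Cons by simp
  qed
  have "b \<in> set (ys @ xs)" using ab U xy by auto
  then obtain us ws where uw: "ys @ xs = us @ b # ws" by (meson split_list)
  have dist: "distinct (a # us @ b # ws)" and len: "n = length us + length ws + 2"
  proof -
    have "distinct (a # (ys @ xs))" using zs(1) xy by auto
    then show "distinct (a # us @ b # ws)" unfolding uw .
    have "n = length (a # (ys @ xs))" using zs(3) xy by simp
    then show "n = length us + length ws + 2" unfolding uw by simp
  qed
  let ?D1 = "pedges (a # us @ [b])" and ?D2 = "pedges (b # ws @ [a])"
  have D12: "D = ?D1 \<union> ?D2" unfolding D uw using pedges_append[of "a # us" b "ws @ [a]"] by simp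
  have 1: "link a b ?D1 (length us)"
    unfolding link_def using dist by (intro exI[of _ us]) auto
  have "link b a ?D2 (length ws)"
    unfolding link_def using dist by (intro exI[of _ ws]) auto
  then have 2: "link a b ?D2 (length ws)" by (rule link_sym)
  have U12: "\<Union>?D1 = set (a # us @ [b])" "\<Union>?D2 = set (b # ws @ [a])"
    by (rule Union_pedges; simp)+
  have int: "\<Union>?D1 \<inter> \<Union>?D2 = {a, b}" unfolding U12 using dist by auto
  \<comment> \<open>A common edge could only be \<open>{a, b}\<close>. Then neither link would have
    an inner vertex, contrary to \<open>3 \<le> n\<close>.\<close>
  have "?D1 \<inter> ?D2 = {}"
  proof (rule ccontr)
    assume "\<not> ?thesis"
    then obtain e where e: "e \<in> ?D1" "e \<in> ?D2" by blast
    have "e \<subseteq> {a, b}" using e int by blast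
    moreover have "card e = 2"
    proof -
      have "\<exists>x y. e = {x, y} \<and> x \<noteq> y" using e(1) dist
      proof -
        have *: "e \<in> pedges vs \<Longrightarrow> distinct vs \<Longrightarrow> \<exists>x y. e = {x, y} \<and> x \<noteq> y" for vs
          by (induction vs rule: pedges.induct) auto
        show ?thesis by (rule *[OF e(1)]) (use dist in auto)
      qed
      then show ?thesis by auto
    qed
    ultimately have "e = {a, b}" using ab(3) by (intro card_subset_eq) auto
    then have "length us = 0" "length ws = 0" using linkD(7)[OF 1] linkD(7)[OF 2] e by auto
    then show False using len zs(2) by simp
  qed
  with that[OF 1 2 int D12 len] show thesis by blast
qed

lemma card_cyc:
  assumes "cyc D n"
  shows "card D = n" "card (\<Union>D) = n" "finite (\<Union>D)" "3 \<le> n" "finite D"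
proof -
  obtain zs where zs: "distinct zs" "3 \<le> n" "length zs = n" "D = pedges (zs @ [hd zs])"
    using assms by (auto simp: cyc_def)
  have ne: "zs \<noteq> []" using zs by auto
  have "\<Union>D = set (zs @ [hd zs])" unfolding zs(4) by (rule Union_pedges) (use zs in auto)
  then have U: "\<Union>D = set zs" using ne by auto
  then show cU: "card (\<Union>D) = n" "finite (\<Union>D)" using zs distinct_card by auto
  show "3 \<le> n" by fact
  show "finite D" using zs finite_pedges by simp
  obtain x y zs' where "zs = x # y # zs'" using zs by (cases zs; cases "tl zs") auto
  then have xy: "x \<in> \<Union>D" "y \<in> \<Union>D" "x \<noteq> y" using U zs(1) by auto
  obtain D1 D2 m1 m2 where D: "link x y D1 m1" "link x y D2 m2" "D = D1 \<union> D2" "n = m1 + m2 + 2" "D1 \<inter> D2 = {}"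
    using cyc_split[OF assms xy] by metis
  then show "card D = n"
    using linkD(2,5)[OF D(1)] linkD(2,5)[OF D(2)] by (simp add: card_Un_disjoint)
qed

text \<open>A plane graph without isolated vertices: the vertices are points of the plane, and \<open>I e\<close> is
  the arc that represents the edge \<open>e\<close>.\<close>

locale plane_graph =
  fixes F :: "complex set set" and I :: "complex set \<Rightarrow> complex set"
  assumes finite_edges: "finite F"
    and arc_edge: "e \<in> F \<Longrightarrow> \<exists>g. arc g \<and> path_image g = I e \<and> {pathstart g, pathfinish g} = e"
    and edges_meet: "e \<in> F \<Longrightarrow> f \<in> F \<Longrightarrow> e \<noteq> f \<Longrightarrow> I e \<inter> I f \<subseteq> e \<inter> f"
begin

definition img :: "complex set set \<Rightarrow> complex set" where
  "img B = \<Union>(I ` B)"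

lemma img_Un: "img (A \<union> B) = img A \<union> img B"
  by (auto simp: img_def)

lemma card_edge: "e \<in> F \<Longrightarrow> card e = 2"
  using arc_edge[of e] arc_distinct_ends by (auto simp: card_2_iff')

lemma edge_subset_I: "e \<in> F \<Longrightarrow> e \<subseteq> I e"
  using arc_edge[of e] pathstart_in_path_image pathfinish_in_path_image by blast

lemma arc_between:
  assumes "{a, b} \<in> F"
  obtains g where "arc g" "path_image g = I {a, b}" "pathstart g = a" "pathfinish g = b"
proof -
  obtain g where g: "arc g" "path_image g = I {a, b}" "{pathstart g, pathfinish g} = {a, b}"
    using arc_edge[OF assms] by blast
  then consider "pathstart g = a" "pathfinish g = b" | "pathstart g = b" "pathfinish g = a"
    by (auto simp: doubleton_eq_iff)
  then show thesis
  proof cases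
    case 1
    with g that show thesis by blast
  next
    case 2
    show thesis by (rule that[of "reversepath g"]) (use g 2 in \<open>auto simp: arc_reversepath\<close>)
  qed
qed

lemma I_Int_img: "e \<in> F \<Longrightarrow> B \<subseteq> F \<Longrightarrow> e \<notin> B \<Longrightarrow> I e \<inter> img B \<subseteq> e \<inter> \<Union>B"
  unfolding img_def using edges_meet[of e] by blast

lemma img_Int_img: "A \<subseteq> F \<Longrightarrow> B \<subseteq> F \<Longrightarrow> A \<inter> B = {} \<Longrightarrow> img A \<inter> img B \<subseteq> \<Union>A \<inter> \<Union>B"
  using I_Int_img[of _ B] unfolding img_def by blast

lemma vertices_subset_img: "B \<subseteq> F \<Longrightarrow> \<Union>B \<subseteq> img B"
  using edge_subset_I unfolding img_def by blast

text \<open>No edge passes through a foreign vertex: the vertex is an end of some edge of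
  \<open>F\<close>, and two arcs meet only in common ends.\<close>

lemma vertex_in_img: "v \<in> \<Union>F \<Longrightarrow> B \<subseteq> F \<Longrightarrow> v \<in> img B \<Longrightarrow> v \<in> \<Union>B"
proof -
  assume v: "v \<in> \<Union>F" and B: "B \<subseteq> F" and "v \<in> img B"
  then obtain e f where ef: "e \<in> B" "v \<in> I e" "f \<in> F" "v \<in> f" by (auto simp: img_def)
  have "v \<in> I f" using ef edge_subset_I by blast
  then have "v \<in> e" using edges_meet[of e f] ef B by blast
  then show "v \<in> \<Union>B" using ef by blast
qed

text \<open>At most the two ends are removed from the arc. The remaining parameters contain the open
  unit interval and so form an interval.\<close>

lemma connected_I_Diff:
  assumes e: "e \<in> F" and W: "W \<inter> I e \<subseteq> e"
  shows "connected (I e - W)"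
proof -
  obtain g where g: "arc g" "path_image g = I e" "{pathstart g, pathfinish g} = e"
    using arc_edge[OF e] by blast
  define T where "T = {t \<in> {0..1}. g t \<notin> W}"
  have inj: "inj_on g {0..1}" using g(1) by (simp add: arc_def)
  have inner: "t \<in> T" if "0 < t" "t < 1" for t
  proof -
    have "g t \<notin> e"
      using inj that g(3) by (auto simp: inj_on_def pathstart_def pathfinish_def)
        (metis atLeastAtMost_iff insert_iff less_eq_real_def order_less_irrefl zero_le_one)+
    moreover have "g t \<in> I e" using that unfolding g(2)[symmetric] path_image_def by auto
    ultimately show ?thesis using W that by (auto simp: T_def)
  qed
  have "is_interval T"
    unfolding is_interval_1
  proof (intro ballI allI impI)
    fix x y z assume "x \<in> T" "y \<in> T" "x \<le> z \<and> z \<le> y"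
    then show "z \<in> T" using inner[of z] by (cases "z = x \<or> z = y") (auto simp: T_def)
  qed
  then have "connected T" by (simp add: is_interval_connected)
  moreover have "continuous_on T g"
    using g(1) by (auto simp: arc_def path_def T_def intro: continuous_on_subset)
  ultimately have "connected (g ` T)" by (simp add: connected_continuous_image)
  moreover have "g ` T = I e - W" unfolding g(2)[symmetric] path_image_def T_def by auto
  ultimately show ?thesis by simp
qed

lemma interior_edge_nonempty: "e \<in> F \<Longrightarrow> I e - e \<noteq> {}"
  using arc_edge[of e] nonempty_simple_path_endless[OF arc_imp_simple_path] by metis

lemma interior_edge_Int_img: "e \<in> F \<Longrightarrow> B \<subseteq> F \<Longrightarrow> e \<notin> B \<Longrightarrow> (I e - e) \<inter> img B = {}"
  using I_Int_img by blast

lemma interior_edge_side: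
  assumes "e \<in> F" "B \<subseteq> F" "e \<notin> B"
  shows "I e - e \<subseteq> inside (img B) \<or> I e - e \<subseteq> outside (img B)"
  using connected_I_Diff[OF assms(1), of e] interior_edge_Int_img[OF assms]
  by (intro connected_inside_or_outside) auto

lemma path_arc:
  assumes "distinct (x # xs)" "xs \<noteq> []" "pedges (x # xs) \<subseteq> F"
  shows "\<exists>g. arc g \<and> path_image g = img (pedges (x # xs)) \<and> pathstart g = x \<and> pathfinish g = last xs"
  using assms
proof (induction xs arbitrary: x)
  case (Cons y zs)
  have xy: "{x, y} \<in> F" using Cons.prems by simp
  obtain g where g: "arc g" "path_image g = I {x, y}" "pathstart g = x" "pathfinish g = y"
    using arc_between[OF xy] by blast
  show ?case
  proof (cases "zs = []")
    case True
    with g show ?thesis by (intro exI[of _ g]) (simp add: img_def)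
  next
    case False
    obtain h where h: "arc h" "path_image h = img (pedges (y # zs))" "pathstart h = y" "pathfinish h = last zs"
      using Cons.IH[of y] Cons.prems False by auto
    have V: "\<Union>(pedges (y # zs)) \<subseteq> set (y # zs)" by (rule Union_pedges_subset)
    have "path_image g \<inter> path_image h \<subseteq> {x, y} \<inter> \<Union>(pedges (y # zs))"
      unfolding g h using Cons.prems V by (intro I_Int_img) auto
    also have "\<dots> \<subseteq> {y}" using V Cons.prems(1) by auto
    finally have "arc (g +++ h)" using g h by (intro arc_join) auto
    moreover have "path_image (g +++ h) = img (pedges (x # y # zs))"
      using g h by (simp add: path_image_join img_def)
    ultimately show ?thesis using g h False by (intro exI[of _ "g +++ h"]) auto
  qed
qed simp

lemma link_arc:
  assumes "link a b D m" "D \<subseteq> F"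
  obtains g where "arc g" "path_image g = img D" "pathstart g = a" "pathfinish g = b"
  using assms path_arc[of a "_ @ [b]"] unfolding link_def by fastforce

section \<open>Cycle interiors, theta curves and chords\<close>

definition inner_edges :: "complex set set \<Rightarrow> complex set set" where
  "inner_edges D = {e \<in> F - D. I e - e \<subseteq> inside (img D)}"

definition inner_vertices :: "complex set set \<Rightarrow> complex set" where
  "inner_vertices D = \<Union>F \<inter> inside (img D)"

lemma finite_vertices: "finite (\<Union>F)"
  by (rule finite_Union[OF finite_edges]) (auto intro!: card_ge_0_finite simp: card_edge)

lemma finite_inner: "finite (inner_edges D)" "finite (inner_vertices D)"
  using finite_edges finite_vertices by (auto simp: inner_edges_def inner_vertices_def)

text \<open>The vertex conditions alone would admit the edge \<open>{a, b}\<close> as two of the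
  three links; hence disjointness of the edge sets is required separately.\<close>

definition theta :: "complex \<Rightarrow> complex \<Rightarrow> complex set set \<Rightarrow> complex set set \<Rightarrow> complex set set \<Rightarrow> bool" where
  "theta a b A B C \<longleftrightarrow> A \<union> B \<union> C \<subseteq> F \<and> A \<inter> B = {} \<and> A \<inter> C = {} \<and> B \<inter> C = {} \<and>
     \<Union>A \<inter> \<Union>B = {a, b} \<and> \<Union>A \<inter> \<Union>C = {a, b} \<and> \<Union>B \<inter> \<Union>C = {a, b} \<and>
     (\<exists>i j k. link a b A i \<and> link a b B j \<and> link a b C k)"

lemma theta_arcs:
  assumes "theta a b A B C"
  obtains f g h where "arc f" "path_image f = img A" "pathstart f = a" "pathfinish f = b"
    "arc g" "path_image g = img B" "pathstart g = a" "pathfinish g = b"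
    "arc h" "path_image h = img C" "pathstart h = a" "pathfinish h = b"
    "img A \<inter> img B = {a, b}" "img A \<inter> img C = {a, b}" "img B \<inter> img C = {a, b}"
proof -
  obtain i j k where l: "link a b A i" "link a b B j" "link a b C k"
    and F: "A \<subseteq> F" "B \<subseteq> F" "C \<subseteq> F"
    using assms by (auto simp: theta_def)
  have "{a, b} \<subseteq> img D" if "D \<subseteq> F" "{a, b} \<subseteq> \<Union>D" for D
    using vertices_subset_img[OF that(1)] that(2) by blast
  then have ab: "{a, b} \<subseteq> img A" "{a, b} \<subseteq> img B" "{a, b} \<subseteq> img C"
    using F linkD(3)[OF l(1)] linkD(3)[OF l(2)] linkD(3)[OF l(3)] by blast+
  have "img A \<inter> img B \<subseteq> {a, b}" "img A \<inter> img C \<subseteq> {a, b}" "img B \<inter> img C \<subseteq> {a, b}"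
  proof -
    have dis: "A \<inter> B = {}" "A \<inter> C = {}" "B \<inter> C = {}"
      and V: "\<Union>A \<inter> \<Union>B = {a, b}" "\<Union>A \<inter> \<Union>C = {a, b}" "\<Union>B \<inter> \<Union>C = {a, b}"
      using assms by (simp_all add: theta_def)
    show "img A \<inter> img B \<subseteq> {a, b}" "img A \<inter> img C \<subseteq> {a, b}" "img B \<inter> img C \<subseteq> {a, b}"
      using img_Int_img[OF F(1,2) dis(1)] img_Int_img[OF F(1,3) dis(2)] img_Int_img[OF F(2,3) dis(3)]
      unfolding V .
  qed
  then have "img A \<inter> img B = {a, b}" "img A \<inter> img C = {a, b}" "img B \<inter> img C = {a, b}"
    using ab by (simp_all add: subset_antisym)
  moreover obtain f where "arc f" "path_image f = img A" "pathstart f = a" "pathfinish f = b"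
    using link_arc[OF l(1) F(1)] by blast
  moreover obtain g where "arc g" "path_image g = img B" "pathstart g = a" "pathfinish g = b"
    using link_arc[OF l(2) F(2)] by blast
  moreover obtain h where "arc h" "path_image h = img C" "pathstart h = a" "pathfinish h = b"
    using link_arc[OF l(3) F(3)] by blast
  ultimately show thesis using that by blast
qed

lemma theta_split:
  assumes "theta a b A B C" "img C \<inter> inside (img (A \<union> B)) \<noteq> {}"
  shows "inside (img (A \<union> C)) \<inter> inside (img (B \<union> C)) = {}"
    "inside (img (A \<union> C)) \<union> inside (img (B \<union> C)) \<union> (img C - {a, b}) = inside (img (A \<union> B))"
proof -
  obtain f g h where *: "arc f" "path_image f = img A" "pathstart f = a" "pathfinish f = b"
    "arc g" "path_image g = img B" "pathstart g = a" "pathfinish g = b"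
    "arc h" "path_image h = img C" "pathstart h = a" "pathfinish h = b"
    "img A \<inter> img B = {a, b}" "img A \<inter> img C = {a, b}" "img B \<inter> img C = {a, b}"
    using theta_arcs[OF assms(1)] by blast
  have "a \<noteq> b" using *(1,3,4) arc_distinct_ends by metis
  then show "inside (img (A \<union> C)) \<inter> inside (img (B \<union> C)) = {}"
    "inside (img (A \<union> C)) \<union> inside (img (B \<union> C)) \<union> (img C - {a, b}) = inside (img (A \<union> B))"
    using split_inside_simple_closed_curve[of f a b g h] * assms(2)
    by (simp_all add: arc_imp_simple_path img_Un)
qed

text \<open>Strictness comes from the edges of \<open>C\<close>: they are inside the old cycle and
  on the new one. This makes the induction on the number of inner edges work.\<close>

lemma inner_edges_theta_mono:
  assumes "theta a b A B C" "inside (img (A \<union> C)) \<subseteq> inside (img (A \<union> B))"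
    and "C \<subseteq> inner_edges (A \<union> B)"
  shows "inner_edges (A \<union> C) \<subset> inner_edges (A \<union> B)"
proof -
  have C: "C \<noteq> {}" using assms(1) linkD(6) by (auto simp: theta_def)
  have "inner_edges (A \<union> C) \<subseteq> inner_edges (A \<union> B)"
  proof
    fix e assume e: "e \<in> inner_edges (A \<union> C)"
    then have *: "e \<in> F" "I e - e \<subseteq> inside (img (A \<union> B))" using assms(2) by (auto simp: inner_edges_def)
    have "e \<notin> A \<union> B"
    proof
      assume "e \<in> A \<union> B"
      then have "I e - e \<subseteq> img (A \<union> B)" by (auto simp: img_def)
      then show False
        using * interior_edge_nonempty[of e] inside_no_overlap[of "img (A \<union> B)"] by blast
    qed
    with * show "e \<in> inner_edges (A \<union> B)" by (simp add: inner_edges_def)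
  qed
  moreover have "C \<inter> inner_edges (A \<union> C) = {}" by (auto simp: inner_edges_def)
  ultimately show ?thesis using C assms(3) by blast
qed

text \<open>The formulation by bipartitions of the edges treats disconnected graphs and cut vertices
  alike. If it fails, \<open>F\<close> splits into two smaller graphs with at most one common
  vertex.\<close>

definition two_connected :: bool where
  "two_connected \<longleftrightarrow> (\<forall>X. X \<noteq> {} \<longrightarrow> X \<subset> F \<longrightarrow> (\<exists>a b. a \<noteq> b \<and> {a, b} \<subseteq> \<Union>X \<inter> \<Union>(F - X)))"

definition avoiding :: "complex set \<Rightarrow> (complex \<times> complex) set" where
  "avoiding W = {(u, v). {u, v} \<in> F \<and> u \<notin> W \<and> v \<notin> W}"

text \<open>This is an ear of \<open>B\<close>: a path that meets \<open>B\<close> only in its two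
  distinct ends, possibly a single edge.\<close>

definition chord :: "complex set set \<Rightarrow> complex \<Rightarrow> complex \<Rightarrow> complex set set \<Rightarrow> bool" where
  "chord B a b P \<longleftrightarrow>
     {a, b} \<subseteq> \<Union>B \<and> (\<exists>m. link a b P m) \<and> P \<subseteq> F - B \<and> \<Union>P \<inter> \<Union>B = {a, b}"

text \<open>If \<open>e\<close> has an end \<open>p\<close> off \<open>B\<close>, the edges at the
  component of \<open>p\<close> in the graph without the vertices of \<open>B\<close> share two
  vertices with the rest. These lie on \<open>B\<close> and are joined through the component. The
  second conjunct records this, so that the chord can be located on the same side of
  \<open>B\<close> as \<open>e\<close>.\<close>

lemma chord_exists:
  assumes tc: two_connected and B: "B \<subseteq> F" "B \<noteq> {}" and e: "e \<in> F - B"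
  shows "\<exists>a b P. chord B a b P \<and>
    (P = {e} \<or> (\<exists>p\<in>e - \<Union>B. \<forall>f\<in>P. \<exists>z\<in>f - \<Union>B. (p, z) \<in> (avoiding (\<Union>B))\<^sup>*))"
proof (cases "e \<subseteq> \<Union>B")
  case True
  obtain p q where pq: "e = {p, q}" "p \<noteq> q" using card_edge[of e] e by (auto simp: card_2_iff)
  have "link p q {e} 0" unfolding link_def using pq by (intro exI[of _ "[]"]) auto
  moreover have "\<Union>{e} \<inter> \<Union>B = {p, q}" "{p, q} \<subseteq> \<Union>B" "{e} \<subseteq> F - B" using True pq(1) e by auto
  ultimately have "chord B p q {e}" unfolding chord_def by blast
  then show ?thesis by blast
next
  case False
  then obtain p where p: "p \<in> e" "p \<notin> \<Union>B" by blast
  let ?W = "\<Union>B"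
  let ?R = "avoiding ?W"
  define U where "U = ?R\<^sup>* `` {p}"
  define X where "X = {f \<in> F. f \<inter> U \<noteq> {}}"
  have UW: "z \<notin> ?W" if "z \<in> U" for z
  proof -
    have "(p, z) \<in> ?R\<^sup>*" using that by (simp add: U_def)
    then show ?thesis using p by cases (auto simp: avoiding_def)
  qed
  have Ustep: "z \<in> U" if "u \<in> U" "{u, z} \<in> F" "z \<notin> ?W" for u z
  proof -
    have "(u, z) \<in> ?R" using that UW[of u] by (simp add: avoiding_def)
    then show ?thesis using that(1) unfolding U_def by (auto intro: rtrancl_into_rtrancl)
  qed
  have "e \<in> X" using e p by (auto simp: X_def U_def)
  moreover have BX: "B \<inter> X = {}" using UW by (auto simp: X_def)
  moreover have "X \<subseteq> F" by (auto simp: X_def)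
  ultimately have X: "X \<noteq> {}" "X \<subset> F" using B by blast+
  then obtain a b where ab: "a \<noteq> b" "{a, b} \<subseteq> \<Union>X \<inter> \<Union>(F - X)"
    using tc unfolding two_connected_def by meson
  have foot: "v \<in> ?W \<and> (\<exists>u\<in>U. {v, u} \<in> F)" if v: "v \<in> \<Union>X \<inter> \<Union>(F - X)" for v
  proof -
    obtain f u where f: "f \<in> F" "v \<in> f" "u \<in> f" "u \<in> U" using v by (auto simp: X_def)
    have vU: "v \<notin> U" using v by (auto simp: X_def)
    then have "v \<noteq> u" using f by blast
    moreover have "finite f" "card f = 2" using card_edge[OF f(1)] by (auto intro: card_ge_0_finite)
    ultimately have "f = {v, u}" using f by (intro card_subset_eq[symmetric]) auto
    then have "{v, u} \<in> F" "{u, v} \<in> F" using f by (auto simp: insert_commute)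
    then show ?thesis using Ustep[of u v] f vU by blast
  qed
  obtain u w where uw: "a \<in> ?W" "u \<in> U" "{a, u} \<in> F" "b \<in> ?W" "w \<in> U" "{b, w} \<in> F"
    using foot[of a] foot[of b] ab(2) by blast
  have symR: "sym (?R\<^sup>*)" by (rule sym_rtrancl) (auto simp: sym_def avoiding_def insert_commute)
  have "(u, p) \<in> ?R\<^sup>*" "(p, w) \<in> ?R\<^sup>*" using uw symR by (auto simp: U_def dest: symD)
  then have "(u, w) \<in> ?R\<^sup>*" by (rule rtrancl_trans)
  then obtain xs where xs: "distinct (u # xs)" "successively (\<lambda>a b. (a, b) \<in> ?R) (u # xs)" "last (u # xs) = w"
    by (rule rtrancl_imp_distinct_path)
  have psU: "set (u # xs) \<subseteq> U"
  proof
    fix z assume z: "z \<in> set (u # xs)"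
    have "\<forall>z\<in>set xs. z \<in> U" if "u \<in> U" "successively (\<lambda>a b. (a, b) \<in> ?R) (u # xs)" for u
      using that
    proof (induction xs arbitrary: u)
      case (Cons y ys)
      then have "y \<in> U" using Ustep[of u y] by (auto simp: avoiding_def)
      then show ?case using Cons by auto
    qed simp
    with z uw(2) xs(2) show "z \<in> U" by auto
  qed
  let ?ps = "u # xs"
  define P where "P = pedges (a # ?ps @ [b])"
  have dist: "distinct (a # ?ps @ [b])" using xs(1) psU UW uw ab(1) by auto
  then have lk: "link a b P (length ?ps)" unfolding link_def P_def by (intro exI[of _ ?ps]) auto
  have "pedges (a # ?ps @ [b]) \<subseteq> F"
  proof (rule successively_imp_pedges)
    have "successively (\<lambda>u v. {u, v} \<in> F) ?ps"
      by (rule successively_mono[OF xs(2)]) (auto simp: avoiding_def)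
    then have "successively (\<lambda>u v. {u, v} \<in> F) (?ps @ [b])"
      unfolding successively_append_iff using xs(3) uw(6) by (simp add: insert_commute)
    then show "successively (\<lambda>u v. {u, v} \<in> F) (a # ?ps @ [b])" using uw(3) by simp
  qed
  then have PF: "P \<subseteq> F" by (simp add: P_def)
  have meets: "\<exists>z\<in>f - ?W. (p, z) \<in> ?R\<^sup>*" if "f \<in> P" for f
  proof -
    have "f \<inter> set ?ps \<noteq> {}" using that unfolding P_def by (intro pedges_meets_inner) auto
    then obtain z where "z \<in> f" "z \<in> U" using psU by blast
    then show ?thesis using UW by (auto simp: U_def)
  qed
  have "P \<inter> B = {}" using meets by blast
  moreover have "\<Union>P \<inter> ?W = {a, b}"
  proof -
    have "\<Union>P = set (a # ?ps @ [b])" unfolding P_def by (rule Union_pedges) simp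
    then show ?thesis using psU UW uw by auto
  qed
  ultimately have "chord B a b P"
    unfolding chord_def using lk PF uw(1,4) by blast
  moreover have "\<exists>p\<in>e - ?W. \<forall>f\<in>P. \<exists>z\<in>f - ?W. (p, z) \<in> ?R\<^sup>*"
    by (rule bexI[of _ p]) (use meets p in auto)
  ultimately show ?thesis by (intro exI conjI disjI2)
qed

text \<open>A walk that avoids the vertices of \<open>B\<close> and consists of edges not in
  \<open>B\<close> never meets \<open>img B\<close>. So the side of \<open>e\<close> is carried over
  from \<open>p\<close> to every edge of the chord.\<close>

lemma chord_on_side:
  assumes tc: two_connected and B: "B \<subseteq> F" "B \<noteq> {}" and e: "e \<in> F - B"
    and X: "X = inside (img B) \<or> X = outside (img B)" "I e - e \<subseteq> X"
  obtains a b P where "chord B a b P" "\<And>f. f \<in> P \<Longrightarrow> I f - f \<subseteq> X"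
proof -
  let ?J = "img B"
  obtain a b P where P: "chord B a b P"
    and c: "P = {e} \<or> (\<exists>p\<in>e - \<Union>B. \<forall>f\<in>P. \<exists>z\<in>f - \<Union>B. (p, z) \<in> (avoiding (\<Union>B))\<^sup>*)"
    using chord_exists[OF tc B e] by (elim exE conjE) (rule that)
  have XJ: "S \<subseteq> X" if "connected S" "S \<inter> ?J = {}" "S \<inter> X \<noteq> {}" for S
    using connected_inside_or_outside[OF that(1,2)] that(3) X(1) inside_Int_outside[of ?J] by blast
  have edge: "I f - ?J \<subseteq> X" if "f \<in> F" "f \<notin> B" "(I f - ?J) \<inter> X \<noteq> {}" for f
  proof (rule XJ[OF _ _ that(3)])
    show "connected (I f - ?J)"
      using I_Int_img[OF that(1) B(1) that(2)] by (intro connected_I_Diff that(1)) blast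
  qed blast
  have vJ: "v \<notin> ?J" if "v \<in> f" "f \<in> F" "v \<notin> \<Union>B" for v f
    using vertex_in_img[OF _ B(1)] that by blast
  have int: "I f - f \<subseteq> I f - ?J" if "f \<in> F" "f \<notin> B" for f
    using interior_edge_Int_img[OF that(1) B(1) that(2)] by blast
  have "I f - f \<subseteq> X" if f: "f \<in> P" for f
    using c
  proof
    assume "P = {e}"
    with f X(2) show ?thesis by simp
  next
    assume "\<exists>p\<in>e - \<Union>B. \<forall>f\<in>P. \<exists>z\<in>f - \<Union>B. (p, z) \<in> (avoiding (\<Union>B))\<^sup>*"
    then obtain p z where p: "p \<in> e" "p \<notin> \<Union>B" and z: "z \<in> f" "z \<notin> \<Union>B"
      and pz: "(p, z) \<in> (avoiding (\<Union>B))\<^sup>*" using f by blast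
    have "(I e - ?J) \<inter> X \<noteq> {}"
      using int[of e] interior_edge_nonempty[of e] X(2) e by blast
    then have "I e - ?J \<subseteq> X" using edge e by blast
    then have pX: "p \<in> X" using vJ[of p e] p e edge_subset_I by blast
    have "z \<in> X" using pz
    proof induction
      case (step u v)
      have uv: "{u, v} \<in> F" "u \<notin> \<Union>B" "v \<notin> \<Union>B" using step.hyps(2) by (auto simp: avoiding_def)
      have "{u, v} \<notin> B" using uv by blast
      moreover have "u \<in> I {u, v} - ?J" "v \<in> I {u, v} - ?J"
        using vJ[of _ "{u, v}"] uv edge_subset_I[OF uv(1)] by auto
      ultimately show ?case using edge[OF uv(1)] step.IH by blast
    qed (rule pX)
    have fF: "f \<in> F" "f \<notin> B" using f P by (auto simp: chord_def)
    have "z \<in> I f - ?J" using vJ[of z f] z fF edge_subset_I by blast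
    then have "I f - ?J \<subseteq> X" using edge[OF fF] \<open>z \<in> X\<close> by blast
    with int[OF fF] show ?thesis by blast
  qed
  with that P show thesis by blast
qed

lemma chord_theta:
  assumes "cyc D n" "D \<subseteq> F" and "chord D a b P"
  obtains A B i j m where "D = A \<union> B" "n = i + j + 2" "theta a b A B P" "link a b P m"
    "link a b A i" "link a b B j" "cyc (A \<union> P) (i + m + 2)" "cyc (B \<union> P) (j + m + 2)"
proof -
  obtain m where P: "{a, b} \<subseteq> \<Union>D" "link a b P m" "P \<subseteq> F - D" "\<Union>P \<inter> \<Union>D = {a, b}"
    using assms(3) unfolding chord_def by blast
  have ab: "a \<noteq> b" using linkD(1)[OF P(2)] .
  obtain A B i j where D: "link a b A i" "link a b B j" "\<Union>A \<inter> \<Union>B = {a, b}"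
    "D = A \<union> B" "n = i + j + 2" "A \<inter> B = {}"
    using cyc_split[OF assms(1)] P(1) ab by (metis insert_subset)
  have int: "\<Union>A \<inter> \<Union>P = {a, b}" "\<Union>B \<inter> \<Union>P = {a, b}"
    using P(4) D(4) linkD(3)[OF D(1)] linkD(3)[OF D(2)] linkD(3)[OF P(2)] by blast+
  have disj: "A \<inter> P = {}" "B \<inter> P = {}" using P(3) D(4) by blast+
  have th: "theta a b A B P"
    unfolding theta_def using D P assms(2) int disj by blast
  \<comment> \<open>Otherwise \<open>A\<close> and \<open>P\<close> would both be the single edge
    \<open>{a, b}\<close>.\<close>
  have "1 \<le> i + m"
  proof (rule ccontr)
    assume "\<not> ?thesis"
    then show False using linkD(8)[OF D(1)] linkD(8)[OF P(2)] disj by auto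
  qed
  moreover have "1 \<le> j + m"
  proof (rule ccontr)
    assume "\<not> ?thesis"
    then show False using linkD(8)[OF D(2)] linkD(8)[OF P(2)] disj by auto
  qed
  ultimately show thesis
    using that[OF D(4,5) th P(2) D(1,2)] cyc_join[OF D(1) P(2) int(1)] cyc_join[OF D(2) P(2) int(2)] by blast
qed

end

section \<open>Counting edges inside a cycle and in the whole graph\<close>

context plane_graph
begin

lemma theta_swap: "theta a b A B C \<Longrightarrow> theta a b B A C" "theta a b A B C \<Longrightarrow> theta a b A C B"
  unfolding theta_def by blast+

lemma theta_meets_inside:
  assumes "C \<noteq> {}" "C \<subseteq> inner_edges (A \<union> B)"
  shows "img C \<inter> inside (img (A \<union> B)) \<noteq> {}"
proof -
  obtain f where f: "f \<in> C" using assms(1) by blast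
  then have "f \<in> F" "I f - f \<subseteq> inside (img (A \<union> B))" using assms(2) by (auto simp: inner_edges_def)
  moreover have "I f \<subseteq> img C" using f by (auto simp: img_def)
  ultimately show ?thesis using interior_edge_nonempty[of f] by blast
qed

text \<open>Euler's formula for a cycle and its interior: a chord splits both into two smaller pieces.\<close>

lemma inner_edges_le:
  assumes tc: two_connected and "cyc D n" "D \<subseteq> F"
  shows "card (inner_edges D) + 3 \<le> 3 * card (inner_vertices D) + n"
  using assms(2,3)
proof (induction "card (inner_edges D)" arbitrary: D n rule: less_induct)
  case less
  let ?J = "img D"
  show ?case
  proof (cases "inner_edges D = {}")
    case True
    then show ?thesis using card_cyc(4)[OF less.prems(1)] by simp
  next
    case False
    then obtain e where e: "e \<in> F - D" "I e - e \<subseteq> inside ?J" by (auto simp: inner_edges_def)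
    have "D \<noteq> {}" using card_cyc(1,4)[OF less.prems(1)] by auto
    then obtain a b P where P: "chord D a b P" "\<And>f. f \<in> P \<Longrightarrow> I f - f \<subseteq> inside ?J"
      using chord_on_side[OF tc less.prems(2) _ e(1) disjI1[OF refl] e(2)] by blast
    obtain A B i j m where AB: "D = A \<union> B" "n = i + j + 2" "theta a b A B P" "link a b P m"
      "link a b A i" "link a b B j" "cyc (A \<union> P) (i + m + 2)" "cyc (B \<union> P) (j + m + 2)"
      using chord_theta[OF less.prems P(1)] by blast
    have PD: "P \<subseteq> F - D" using P(1) by (simp add: chord_def)
    have Pin: "P \<subseteq> inner_edges (A \<union> B)" "P \<subseteq> inner_edges (B \<union> A)"
      using P(2) PD AB(1) by (auto simp: inner_edges_def Un_commute)
    have Pne: "P \<noteq> {}" using linkD(6)[OF AB(4)] .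
    note split = theta_split[OF AB(3) theta_meets_inside[OF Pne Pin(1)]]
    have BAeq: "img (B \<union> A) = img (A \<union> B)" by (simp add: Un_commute)
    have mono: "inner_edges (A \<union> P) \<subset> inner_edges D" "inner_edges (B \<union> P) \<subset> inner_edges D"
      using inner_edges_theta_mono[OF AB(3) _ Pin(1)]
        inner_edges_theta_mono[OF theta_swap(1)[OF AB(3)] _ Pin(2)] split(2)
      unfolding BAeq AB(1) by (auto simp: Un_commute)
    have IH1: "card (inner_edges (A \<union> P)) + 3 \<le> 3 * card (inner_vertices (A \<union> P)) + (i + m + 2)"
      by (rule less.hyps[OF _ AB(7)]) (use mono(1) finite_inner PD AB(1) less.prems(2) in \<open>auto intro: psubset_card_mono\<close>)
    have IH2: "card (inner_edges (B \<union> P)) + 3 \<le> 3 * card (inner_vertices (B \<union> P)) + (j + m + 2)"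
      by (rule less.hyps[OF _ AB(8)]) (use mono(2) finite_inner PD AB(1) less.prems(2) in \<open>auto intro: psubset_card_mono\<close>)
    have "inner_edges D \<subseteq> inner_edges (A \<union> P) \<union> inner_edges (B \<union> P) \<union> P"
    proof
      fix f assume f: "f \<in> inner_edges D"
      show "f \<in> inner_edges (A \<union> P) \<union> inner_edges (B \<union> P) \<union> P"
      proof (cases "f \<in> P")
        case False
        have fF: "f \<in> F" "f \<notin> A \<union> P" "f \<notin> B \<union> P" "I f - f \<subseteq> inside (img (A \<union> B))"
          using f False AB(1) by (auto simp: inner_edges_def)
        have sub: "A \<union> P \<subseteq> F" "P \<subseteq> F" using PD AB(1) less.prems(2) by auto
        have noP: "(I f - f) \<inter> img P = {}"
          using interior_edge_Int_img[OF fF(1) sub(2) False] .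
        have "I f - f \<subseteq> inside (img (A \<union> P)) \<or> I f - f \<subseteq> inside (img (B \<union> P))"
          using interior_edge_side[OF fF(1) sub(1) fF(2)]
        proof
          assume "I f - f \<subseteq> outside (img (A \<union> P))"
          then have "(I f - f) \<inter> inside (img (A \<union> P)) = {}"
            using inside_Int_outside[of "img (A \<union> P)"] by blast
          then show ?thesis using fF(4) noP split(2) by blast
        qed simp
        then show ?thesis using fF by (auto simp: inner_edges_def)
      qed simp
    qed
    then have "card (inner_edges D) \<le> card (inner_edges (A \<union> P) \<union> inner_edges (B \<union> P) \<union> P)"
      using finite_inner linkD(5)[OF AB(4)] by (intro card_mono) auto
    also have "\<dots> \<le> card (inner_edges (A \<union> P)) + card (inner_edges (B \<union> P)) + card P"
      by (meson add_mono_thms_linordered_semiring(3) card_Un_le order_trans)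
    finally have E: "card (inner_edges D) \<le> card (inner_edges (A \<union> P)) + card (inner_edges (B \<union> P)) + (m + 1)"
      using linkD(2)[OF AB(4)] by simp
    let ?P = "\<Union>P - {a, b}"
    have Pimg: "?P \<subseteq> img P - {a, b}" using vertices_subset_img[of P] PD by blast
    have d1: "inner_vertices (A \<union> P) \<inter> inner_vertices (B \<union> P) = {}"
      using split(1) by (auto simp: inner_vertices_def)
    have d2: "(inner_vertices (A \<union> P) \<union> inner_vertices (B \<union> P)) \<inter> ?P = {}"
      using Pimg inside_no_overlap[of "img (A \<union> P)"] inside_no_overlap[of "img (B \<union> P)"]
      unfolding inner_vertices_def img_Un by blast
    have fP: "finite ?P" using linkD(9)[OF AB(4)] by simp
    have "card (inner_vertices (A \<union> P)) + card (inner_vertices (B \<union> P)) + m =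
        card (inner_vertices (A \<union> P) \<union> inner_vertices (B \<union> P) \<union> ?P)"
      using d1 d2 fP finite_inner linkD(4)[OF AB(4)] by (simp add: card_Un_disjoint)
    also have "\<dots> \<le> card (inner_vertices D)"
    proof (rule card_mono[OF finite_inner(2)])
      have "\<Union>P \<subseteq> \<Union>F" using PD by blast
      then show "inner_vertices (A \<union> P) \<union> inner_vertices (B \<union> P) \<union> ?P \<subseteq> inner_vertices D"
        using Pimg split(2) unfolding inner_vertices_def AB(1) by blast
    qed
    \<comment> \<open>The two boundary lengths add up to \<open>n + 2 * m + 2\<close>. Together with
      the \<open>m + 1\<close> edges of the chord this is \<open>n + 3 * m + 3\<close>: its
      \<open>m\<close> inner vertices absorb \<open>3 * m\<close>, and the second constant 3 of the
      induction hypotheses absorbs the rest.\<close>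
    finally show ?thesis using IH1 IH2 E AB(2) by linarith
  qed
qed

text \<open>If \<open>B\<close> runs inside the cycle of \<open>A\<close> and \<open>P\<close>, this
  cycle encloses everything the old one did and in addition the edges of \<open>B\<close>, of which
  there is at least one.\<close>

lemma theta_enlarge:
  assumes th: "theta a b A B P" and out: "\<And>f. f \<in> P \<Longrightarrow> I f - f \<subseteq> outside (img (A \<union> B))"
    and ins: "img B \<inter> inside (img (A \<union> P)) \<noteq> {}"
  shows "card (inner_edges (A \<union> B)) < card (inner_edges (A \<union> P))"
proof -
  have F: "A \<subseteq> F" "B \<subseteq> F" "P \<subseteq> F" and dis: "A \<inter> B = {}" "B \<inter> P = {}"
    using th by (auto simp: theta_def)
  obtain j where lB: "link a b B j" using th by (auto simp: theta_def)
  have "inside (img (A \<union> B)) \<union> inside (img (P \<union> B)) \<union> (img B - {a, b}) = inside (img (A \<union> P))"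
    by (rule theta_split(2)[OF theta_swap(2)[OF th] ins])
  then have sub: "inside (img (A \<union> B)) \<subseteq> inside (img (A \<union> P))" "img B - {a, b} \<subseteq> inside (img (A \<union> P))"
    by blast+
  have "inner_edges (A \<union> B) \<union> B \<subseteq> inner_edges (A \<union> P)"
  proof
    fix f assume f: "f \<in> inner_edges (A \<union> B) \<union> B"
    show "f \<in> inner_edges (A \<union> P)"
    proof (cases "f \<in> B")
      case True
      have "{a, b} \<subseteq> \<Union>F" using linkD(3)[OF lB] F by blast
      then have "{a, b} \<inter> I f \<subseteq> f"
        using vertex_in_img[of _ "{f}"] True F by (auto simp: img_def)
      moreover have "I f \<subseteq> img B" using True by (auto simp: img_def)
      ultimately have "I f - f \<subseteq> inside (img (A \<union> P))" using sub(2) by blast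
      then show ?thesis using True F dis by (auto simp: inner_edges_def)
    next
      case False
      then have f: "f \<in> F" "f \<notin> A" "I f - f \<subseteq> inside (img (A \<union> B))"
        using f by (auto simp: inner_edges_def)
      have "f \<notin> P"
        using out[of f] f interior_edge_nonempty[OF f(1)] inside_Int_outside[of "img (A \<union> B)"] by blast
      then show ?thesis using f sub(1) by (auto simp: inner_edges_def)
    qed
  qed
  then have "card (inner_edges (A \<union> B) \<union> B) \<le> card (inner_edges (A \<union> P))"
    by (rule card_mono[OF finite_inner(1)])
  moreover have "card (inner_edges (A \<union> B) \<union> B) = card (inner_edges (A \<union> B)) + card B"
    by (rule card_Un_disjoint[OF finite_inner(1) linkD(5)[OF lB]]) (auto simp: inner_edges_def)
  ultimately show ?thesis using linkD(2)[OF lB] by linarith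
qed

text \<open>A cycle with the most edges inside has no edge outside: a chord outside would form a theta curve
  with it, in which some other cycle encloses more edges.\<close>

lemma two_connected_edges_le:
  assumes tc: two_connected and F2: "2 \<le> card F"
  shows "card F + 3 \<le> 3 * card (\<Union>F)"
proof -
  define Q where "Q D \<longleftrightarrow> D \<subseteq> F \<and> (\<exists>n. cyc D n)" for D
  \<comment> \<open>An edge \<open>e\<close> together with a chord of \<open>{e}\<close> is a
    cycle.\<close>
  have "\<exists>D. Q D"
  proof -
    obtain e where e: "e \<in> F" using F2 by fastforce
    obtain f where f: "f \<in> F - {e}"
      using F2 e finite_edges by (metis card_le_Suc0_iff_eq Diff_iff One_nat_def Suc_1 not_less_eq_eq singletonD)
    obtain a b P where P: "chord {e} a b P"
      using chord_exists[OF tc _ _ f] e by blast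
    then obtain m where m: "link a b P m" "{a, b} \<subseteq> e" "e \<notin> P" "P \<subseteq> F" "\<Union>P \<inter> e = {a, b}"
      by (auto simp: chord_def)
    have ab: "a \<noteq> b" using linkD(1)[OF m(1)] .
    have "finite e" using card_edge[OF e] by (auto intro: card_ge_0_finite)
    then have eab: "e = {a, b}" using m(2) ab card_edge[OF e] by (intro card_subset_eq[symmetric]) auto
    have l: "link a b {e} 0" unfolding link_def using ab eab by (intro exI[of _ "[]"]) auto
    have "1 \<le> m" using linkD(8)[OF m(1)] m(3) eab by (cases m) auto
    then have "cyc ({e} \<union> P) (0 + m + 2)"
      using m(5) eab by (intro cyc_join[OF l m(1)]) auto
    moreover have "{e} \<union> P \<subseteq> F" using e m(4) by simp
    ultimately show ?thesis unfolding Q_def by blast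
  qed
  then obtain D0 where "Q D0" ..
  moreover have "\<forall>D. Q D \<longrightarrow> card (inner_edges D) < Suc (card F)"
    using card_mono[OF finite_edges, of "inner_edges _"]
    by (auto simp: less_Suc_eq_le inner_edges_def)
  ultimately have "\<exists>D. Q D \<and> (\<forall>D'. Q D' \<longrightarrow> card (inner_edges D') \<le> card (inner_edges D))"
    by (rule Lattices_Big.ex_has_greatest_nat)
  then obtain D where D: "Q D" and mx: "\<forall>D'. Q D' \<longrightarrow> card (inner_edges D') \<le> card (inner_edges D)"
    by (elim exE conjE)
  then obtain n where n: "cyc D n" and DF: "D \<subseteq> F" by (auto simp: Q_def)
  have Dne: "D \<noteq> {}" using card_cyc(1,4)[OF n] by auto
  have "F \<subseteq> D \<union> inner_edges D"
  proof
    fix f assume f: "f \<in> F"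
    show "f \<in> D \<union> inner_edges D"
    proof (rule ccontr)
      assume no: "\<not> ?thesis"
      then have fD: "f \<in> F - D" using f by blast
      have fo: "I f - f \<subseteq> outside (img D)"
        using interior_edge_side[OF f DF] no f by (auto simp: inner_edges_def)
      obtain a b P where P: "chord D a b P" "\<And>f. f \<in> P \<Longrightarrow> I f - f \<subseteq> outside (img D)"
        using chord_on_side[OF tc DF Dne fD disjI2[OF refl] fo] by blast
      obtain A B i j m where AB: "D = A \<union> B" "theta a b A B P"
        "cyc (A \<union> P) (i + m + 2)" "cyc (B \<union> P) (j + m + 2)"
        using chord_theta[OF n DF P(1)] by metis
      have PF: "P \<subseteq> F" using P(1) by (auto simp: chord_def)
      obtain g1 g2 g where g: "arc g1" "path_image g1 = img A" "pathstart g1 = a" "pathfinish g1 = b"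
        "arc g2" "path_image g2 = img B" "pathstart g2 = a" "pathfinish g2 = b"
        "arc g" "path_image g = img P" "pathstart g = a" "pathfinish g = b"
        "img A \<inter> img B = {a, b}" "img A \<inter> img P = {a, b}" "img B \<inter> img P = {a, b}"
        by (rule theta_arcs[OF AB(2)])
      \<comment> \<open>Only the vertices on the chord need an argument: one off
        \<open>img D\<close> is connected, along its arc and off \<open>img D\<close>, to inner
        points of the arc, which lie outside.\<close>
      have "img P \<inter> inside (img D) = {}"
      proof -
        have "x \<notin> inside (img D)" if x: "x \<in> I h" "h \<in> P" for x h
        proof (cases "x \<in> h")
          case True
          have "x \<in> outside (img D) \<or> x \<in> img D"
          proof (cases "x \<in> img D")
            case False
            have hF: "h \<in> F" "h \<notin> D" using x PF P(1) by (auto simp: chord_def)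
            have "connected (I h - img D)"
              using I_Int_img[OF hF(1) DF hF(2)] by (intro connected_I_Diff hF(1)) blast
            then have "I h - img D \<subseteq> inside (img D) \<or> I h - img D \<subseteq> outside (img D)"
              by (rule connected_inside_or_outside) blast
            moreover have "I h - h \<subseteq> I h - img D"
              using interior_edge_Int_img[OF hF(1) DF hF(2)] by blast
            ultimately show ?thesis
              using P(2)[OF x(2)] interior_edge_nonempty[OF hF(1)] inside_Int_outside[of "img D"] False x(1)
              by blast
          qed simp
          then show ?thesis
            using inside_Int_outside[of "img D"] inside_no_overlap[of "img D"] by blast
        next
          case False
          then show ?thesis using P(2)[OF x(2)] x(1) inside_Int_outside[of "img D"] by blast
        qed
        then show ?thesis unfolding img_def[of P] by blast
      qed
      then have "img B \<inter> inside (img (A \<union> P)) \<noteq> {} \<or> img A \<inter> inside (img (B \<union> P)) \<noteq> {}"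
        using theta_some_inside[OF g(1,5,9,3,4,7,8,11,12)] g unfolding AB(1) img_Un by simp
      then show False
      proof
        assume "img B \<inter> inside (img (A \<union> P)) \<noteq> {}"
        then have "card (inner_edges D) < card (inner_edges (A \<union> P))"
          using theta_enlarge[OF AB(2)] P(2) unfolding AB(1) by blast
        moreover have "Q (A \<union> P)" using AB DF PF by (auto simp: Q_def)
        ultimately show False using mx by (meson not_less)
      next
        assume "img A \<inter> inside (img (B \<union> P)) \<noteq> {}"
        then have "card (inner_edges (B \<union> A)) < card (inner_edges (B \<union> P))"
          using theta_enlarge[OF theta_swap(1)[OF AB(2)]] P(2) unfolding AB(1) Un_commute[of A B] by blast
        then have "card (inner_edges D) < card (inner_edges (B \<union> P))"
          unfolding AB(1) Un_commute[of A B] .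
        moreover have "Q (B \<union> P)" using AB DF PF by (auto simp: Q_def)
        ultimately show False using mx by (meson not_less)
      qed
    qed
  qed
  then have "card F \<le> card (D \<union> inner_edges D)"
    using card_cyc(5)[OF n] finite_inner by (intro card_mono) auto
  also have "\<dots> \<le> n + card (inner_edges D)"
    using card_Un_le[of D "inner_edges D"] card_cyc(1)[OF n] by simp
  finally have "card F \<le> n + card (inner_edges D)" .
  moreover have "card (inner_edges D) + 3 \<le> 3 * card (inner_vertices D) + n"
    by (rule inner_edges_le[OF tc n DF])
  moreover have "card (inner_vertices D) + n \<le> card (\<Union>F)"
  proof -
    have "inner_vertices D \<inter> \<Union>D = {}"
      using vertices_subset_img[OF DF] inside_no_overlap[of "img D"] unfolding inner_vertices_def by blast
    then have "card (inner_vertices D) + n = card (inner_vertices D \<union> \<Union>D)"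
      using finite_inner card_cyc(2,3)[OF n] by (simp add: card_Un_disjoint)
    also have "\<dots> \<le> card (\<Union>F)"
      using DF by (intro card_mono finite_vertices) (auto simp: inner_vertices_def)
    finally show ?thesis .
  qed
  ultimately show ?thesis by linarith
qed

end

text \<open>If \<open>F\<close> is not two-connected, it falls into two parts with at most one
  common vertex. A shared vertex is counted twice and costs 3, which is exactly the constant gained
  by adding the two bounds.\<close>

theorem plane_graph_edges_le:
  assumes "plane_graph F I" "F \<noteq> {}"
  shows "card F + 3 \<le> 3 * card (\<Union>F)"
  using assms
proof (induction "card F" arbitrary: F rule: less_induct)
  case less
  interpret plane_graph F I by fact
  consider "card F = 1" | "2 \<le> card F" two_connected | "\<not> two_connected"
    using less.prems(2) finite_edges by (metis One_nat_def Suc_1 card_0_eq le_antisym not_less_eq_eq not_one_le_zero zero_neq_one le_0_eq less_Suc_eq_le linorder_not_less)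
  then show ?case
  proof cases
    case 1
    then obtain e where e: "F = {e}" by (auto simp: card_1_singleton_iff)
    then show ?thesis using card_edge[of e] by simp
  next
    case 2
    then show ?thesis by (intro two_connected_edges_le)
  next
    case 3
    then obtain X where X: "X \<noteq> {}" "X \<subset> F" and no: "\<And>a b. a \<noteq> b \<Longrightarrow> \<not> {a, b} \<subseteq> \<Union>X \<inter> \<Union>(F - X)"
      by (auto simp: two_connected_def)
    let ?Y = "F - X"
    have sub: "plane_graph Y I" if Y: "Y \<subseteq> F" for Y
    proof
      show "finite Y" using Y finite_edges by (rule finite_subset)
    next
      fix e assume "e \<in> Y"
      then show "\<exists>g. arc g \<and> path_image g = I e \<and> {pathstart g, pathfinish g} = e"
        using arc_edge Y by blast
    next
      fix e f assume "e \<in> Y" "f \<in> Y" "e \<noteq> f"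
      then show "I e \<inter> I f \<subseteq> e \<inter> f" using edges_meet Y by blast
    qed
    have finX: "finite X" using X finite_edges by (auto intro: finite_subset)
    have cF: "card F = card X + card ?Y"
      using X finite_edges finX by (metis card_Diff_subset card_mono le_add_diff_inverse psubsetE)
    have c0: "card X > 0" "card ?Y > 0" using X finX finite_edges by (auto simp: card_gt_0_iff)
    have IH1: "card X + 3 \<le> 3 * card (\<Union>X)"
      using less.hyps[of X] sub[of X] X c0 cF by auto
    have IH2: "card ?Y + 3 \<le> 3 * card (\<Union>?Y)"
      using less.hyps[of ?Y] sub[of ?Y] X c0 cF by auto
    have finV: "finite (\<Union>X)" "finite (\<Union>?Y)"
      using finite_vertices X by (auto intro: finite_subset[of _ "\<Union>F"])
    have "\<forall>a\<in>\<Union>X \<inter> \<Union>?Y. \<forall>b\<in>\<Union>X \<inter> \<Union>?Y. a = b" using no by blast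
    then have "card (\<Union>X \<inter> \<Union>?Y) \<le> 1"
      using finV by (simp add: card_le_Suc0_iff_eq)
    moreover have "card (\<Union>X) + card (\<Union>?Y) = card (\<Union>F) + card (\<Union>X \<inter> \<Union>?Y)"
    proof -
      have "\<Union>X \<union> \<Union>?Y = \<Union>F" using X by blast
      then show ?thesis using card_Un_Int[OF finV] by simp
    qed
    ultimately show ?thesis using IH1 IH2 cF by linarith
  qed
qed

section \<open>1-planar graphs\<close>

text \<open>Vertices are replaced by their points. Injectivity of \<open>pos\<close> preserves both
  counts and lets \<open>I\<close> recover the arc of an edge from its pair of endpoints.\<close>

lemma crossing_free_edges_le:
  assumes dr: "plane_drawing V E pos \<gamma>" and sg: "simple_graph V E" and G: "G \<subseteq> E" "G \<noteq> {}"
    and free: "\<And>e f. e \<in> G \<Longrightarrow> f \<in> G \<Longrightarrow> e \<noteq> f \<Longrightarrow> path_image (\<gamma> e) \<inter> path_image (\<gamma> f) \<subseteq> pos ` V"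
  shows "card G + 3 \<le> 3 * card (\<Union>G)"
proof -
  have inj: "inj_on pos V" and e: "\<And>e. e \<in> E \<Longrightarrow> arc (\<gamma> e)"
      "\<And>e. e \<in> E \<Longrightarrow> {pathstart (\<gamma> e), pathfinish (\<gamma> e)} = pos ` e"
      "\<And>e. e \<in> E \<Longrightarrow> path_image (\<gamma> e) \<inter> pos ` V = pos ` e"
    using dr by (auto simp: plane_drawing_def)
  have sub: "e \<subseteq> V" if "e \<in> G" for e using sg G that by (auto simp: simple_graph_def)
  have finV: "finite V" using sg by (simp add: simple_graph_def)
  have finG: "finite G" using finV sub by (intro finite_subset[of G "Pow V"]) auto
  have injG: "inj_on ((`) pos) G"
    by (rule inj_onI) (use inj_on_image_eq_iff[OF inj] sub in blast)
  define I where "I X = path_image (\<gamma> (inv_into G ((`) pos) X))" for X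
  have I: "I (pos ` e) = path_image (\<gamma> e)" if "e \<in> G" for e
    unfolding I_def using inv_into_f_f[OF injG that] by simp
  have "plane_graph ((`) pos ` G) I"
  proof
    show "finite ((`) pos ` G)" using finG by simp
  next
    fix X assume "X \<in> (`) pos ` G"
    then obtain h where h: "h \<in> G" "X = pos ` h" by blast
    then show "\<exists>g. arc g \<and> path_image g = I X \<and> {pathstart g, pathfinish g} = X"
      using e(1,2)[of h] I[OF h(1)] G(1) by (intro exI[of _ "\<gamma> h"]) auto
  next
    fix X Y assume "X \<in> (`) pos ` G" "Y \<in> (`) pos ` G" "X \<noteq> Y"
    then obtain h l where hl: "h \<in> G" "X = pos ` h" "l \<in> G" "Y = pos ` l" "h \<noteq> l" by blast
    have "path_image (\<gamma> h) \<inter> path_image (\<gamma> l) \<subseteq> pos ` h \<inter> pos ` l"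
    proof -
      have "h \<in> E" "l \<in> E" using hl(1,3) G(1) by auto
      from free[OF hl(1,3,5)] e(3)[OF this(1)] e(3)[OF this(2)] show ?thesis by blast
    qed
    then show "I X \<inter> I Y \<subseteq> X \<inter> Y" unfolding hl(2,4) I[OF hl(1)] I[OF hl(3)] .
  qed
  then have "card ((`) pos ` G) + 3 \<le> 3 * card (\<Union>((`) pos ` G))"
    using G(2) by (intro plane_graph_edges_le) auto
  moreover have "card ((`) pos ` G) = card G" by (rule card_image[OF injG])
  moreover have "card (\<Union>((`) pos ` G)) = card (\<Union>G)"
  proof -
    have "\<Union>((`) pos ` G) = pos ` \<Union>G" by blast
    moreover have "inj_on pos (\<Union>G)" using inj by (rule inj_on_subset) (use sub in blast)
    ultimately show ?thesis by (simp add: card_image)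
  qed
  ultimately show ?thesis by simp
qed

text \<open>Crossings pair up some of the edges, so the edges split into two classes without crossings,
  each of which is a plane graph.\<close>

lemma one_planar_edges_less:
  assumes sg: "simple_graph V E" and op: "one_planar V E" and F: "F \<subseteq> E" "F \<noteq> {}"
  shows "card F < 6 * card (\<Union>F)"
proof -
  obtain pos \<gamma> where dr: "plane_drawing V E pos \<gamma>"
    and one: "\<forall>e\<in>E. \<forall>x\<in>crossings V E pos \<gamma> e. \<forall>y\<in>crossings V E pos \<gamma> e. x = y"
    using op unfolding one_planar_def by (elim exE conjE)
  define cr where "cr e f \<longleftrightarrow> e \<noteq> f \<and> \<not> path_image (\<gamma> e) \<inter> path_image (\<gamma> f) \<subseteq> pos ` V" for e f
  have cr_sym: "cr e f \<longleftrightarrow> cr f e" for e f by (auto simp: cr_def)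
  have cr_unique: "f = g" if efg: "e \<in> E" "f \<in> E" "g \<in> E" "cr e f" "cr e g" for e f g
  proof -
    obtain p q where "(f, p) \<in> crossings V E pos \<gamma> e" "(g, q) \<in> crossings V E pos \<gamma> e"
      using efg by (auto simp: cr_def crossings_def)
    then show ?thesis using bspec[OF one efg(1)] by blast
  qed
  have finV: "finite V" using sg by (simp add: simple_graph_def)
  have FV: "\<Union>F \<subseteq> V" using sg F by (auto simp: simple_graph_def)
  have finF: "finite F" using finV FV by (intro finite_subset[of F "Pow V"]) auto
  have finU: "finite (\<Union>F)" using finV FV by (rule finite_subset[rotated])
  define Q where "Q A \<longleftrightarrow> A \<subseteq> F \<and> (\<forall>e\<in>A. \<forall>f\<in>A. \<not> cr e f)" for A
  have "Q {}" by (simp add: Q_def)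
  moreover have "\<forall>A. Q A \<longrightarrow> card A < Suc (card F)"
    using card_mono[OF finF] by (auto simp: Q_def less_Suc_eq_le)
  ultimately have "\<exists>A. Q A \<and> (\<forall>B. Q B \<longrightarrow> card B \<le> card A)"
    by (rule Lattices_Big.ex_has_greatest_nat)
  then obtain A where A: "Q A" and mx: "\<forall>B. Q B \<longrightarrow> card B \<le> card A"
    by (elim exE conjE)
  have AF: "A \<subseteq> F" using A by (simp add: Q_def)
  \<comment> \<open>If \<open>e\<close> and \<open>f\<close> outside \<open>A\<close> crossed,
    \<open>e\<close> would cross no other edge and could be added to \<open>A\<close>, which is a
    largest set without crossings.\<close>
  have rest: "\<not> cr e f" if ef: "e \<in> F - A" "f \<in> F - A" for e f
  proof
    assume c: "cr e f"
    have "\<not> cr e g" if "g \<in> A" for g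
      using cr_unique[of e f g] c ef that AF F(1) by blast
    moreover have "\<not> cr e e" by (simp add: cr_def)
    ultimately have "Q (insert e A)"
      using A ef cr_sym by (auto simp: Q_def)
    then have "card (insert e A) \<le> card A" using mx by blast
    moreover have "finite A" using AF finF by (rule finite_subset)
    ultimately show False using ef by simp
  qed
  \<comment> \<open>The second alternative is for an empty class, to which the bound for plane
    graphs does not apply.\<close>
  have bound: "card G + 3 \<le> 3 * card (\<Union>F) \<or> card G = 0"
    if G: "G \<subseteq> F" "\<And>e f. e \<in> G \<Longrightarrow> f \<in> G \<Longrightarrow> \<not> cr e f" for G
  proof (cases "G = {}")
    case False
    have "card G + 3 \<le> 3 * card (\<Union>G)"
      by (rule crossing_free_edges_le[OF dr sg _ False]) (use G F cr_def in blast)+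
    also have "card (\<Union>G) \<le> card (\<Union>F)" using G by (intro card_mono finU) auto
    finally show ?thesis by simp
  qed simp
  have "card F = card A + card (F - A)"
    using AF finF by (metis card_Diff_subset card_mono finite_subset le_add_diff_inverse)
  moreover have "card F > 0" using F(2) finF by (simp add: card_gt_0_iff)
  moreover have "card A + 3 \<le> 3 * card (\<Union>F) \<or> card A = 0"
    by (rule bound) (use A in \<open>auto simp: Q_def\<close>)
  moreover have "card (F - A) + 3 \<le> 3 * card (\<Union>F) \<or> card (F - A) = 0"
    by (rule bound) (use rest in auto)
  ultimately show ?thesis by linarith
qed

theorem theorem5p3:
  fixes V :: "'a set" and E :: "'a set set"
  assumes "simple_graph V E"
    and "one_planar V E"
  shows "equitable_edge_chromatic_threshold V E \<le> 18 \<and>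
    (\<forall>k\<ge>18. \<exists>\<phi>. equitable_edge_coloring V E k \<phi>)"
proof -
  have "finite E"
    using assms(1) by (intro finite_subset[of E "Pow V"]) (auto simp: simple_graph_def)
  moreover have "\<forall>e\<in>E. card e = 2"
    using assms(1) by (simp add: simple_graph_def)
  ultimately have "\<forall>k\<ge>18. \<exists>\<phi>. equitable_edge_coloring V E k \<phi>"
    using one_planar_edges_less[OF assms] by (intro allI impI equitable_edge_coloring_if_sparse)
  then show ?thesis
    using equitable_edge_chromatic_threshold_le_iff[OF assms(1)] by blast
qed

end
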